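(* Let $p,q$ be relatively prime positive integers and let $$\Phi_{p,q}:\overline{D^2}\to\mathbb{C}^2,\qquad re^{i\theta}\mapsto\frac{r^{\sqrt{pq}}}{\sqrt{p+q}}\begin{pmatrix}\sqrt{q}\,e^{ip\theta}\\ i\sqrt{p}\,e^{-iq\theta}\end{pmatrix}.$$ Then $\Phi_{p,q}$ is $B_1(0)$-free boundary Hamiltonian stationary Lagrangian with the localization property.
   Context: $D^2\subset\mathbb{C}\cong\mathbb{R}^2$ is the open unit disc and $B_1(0)\subset\mathbb{C}^2$ the open unit ball. On $\mathbb{C}^2\cong\mathbb{R}^4$ with coordinates $z_j=x_j+iy_j$, $\cdot$ and $\langle\cdot,\cdot\rangle$ denote the Euclidean real inner product, $I$ is complex multiplication by $i$, $\omega=dx_1\wedge dy_1+dx_2\wedge dy_2$, and $\nabla f$ is the Euclidean gradient of a real function $f$ on $\mathbb{C}^2$. A map $u$ on $D^2$ is Lagrangian if $u^*\omega=0$ a.e. For an open $\Omega\subset\mathbb{C}^2$ with smooth boundary and outer normal $N$, a Lagrangian map $u\in C^1(\overline{D^2},\mathbb{C}^2)$ with $u(\partial D^2)\subset\partial\Omega$ is called $\Omega$-free boundary Hamiltonian stationary with the localization property if for every smooth, relatively open domain $U\subset\overline{D^2}$ $$\int_U\langle d(I(\nabla f)\circ u);du\rangle=0$$ for every smooth $f:\mathbb{C}^2\to\mathbb{R}$ supported away from $u(\partial U\cap D^2)$ such that $I\nabla f(x)\cdot N(x)=0$ for every $x$ in a neighbourhood of $u(\overline{U}\cap\partial D^2)$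 in $\partial\Omega$. Here $\Omega=B_1(0)$ and $N(x)=x$ on $\mathbb{S}^3$. *)

theory Defs
  imports "HOL-Analysis.Analysis"
begin

text \<open>\<open>\<complex>\<^sup>2\<close> is the type \<^typ>\<open>complex \<times> complex\<close>, whose library inner product and norm are the
  Euclidean ones of \<open>\<real>\<^sup>4\<close>.\<close>

definition mult_I :: "complex \<times> complex \<Rightarrow> complex \<times> complex" where
  "mult_I v = (\<i> * fst v, \<i> * snd v)"

definition symp_form :: "complex \<times> complex \<Rightarrow> complex \<times> complex \<Rightarrow> real" where
  "symp_form v w =
     (Re (fst v) * Im (fst w) - Im (fst v) * Re (fst w)) +
     (Re (snd v) * Im (snd w) - Im (snd v) * Re (snd w))"

definition grad :: "('a::real_inner \<Rightarrow> real) \<Rightarrow> 'a \<Rightarrow> 'a" where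
  "grad f x = (THE D. GDERIV f x :> D)"

text \<open>\<open>C\<^sup>k\<close> on an open set \<open>S\<close> of a finite-dimensional space: by recursion on \<open>k\<close>, all directional
  derivatives are \<open>C\<^sup>k\<^sup>-\<^sup>1\<close>.\<close>

primrec Ck_on ::
    "nat \<Rightarrow> 'a::euclidean_space set \<Rightarrow> ('a \<Rightarrow> 'b::real_normed_vector) \<Rightarrow> bool" where
  "Ck_on 0 S f \<longleftrightarrow> continuous_on S f"
| "Ck_on (Suc k) S f \<longleftrightarrow>
     (\<forall>x\<in>S. f differentiable (at x)) \<and>
     (\<forall>v. Ck_on k S (\<lambda>x. frechet_derivative f (at x) v))"

definition smooth_on :: "'a::euclidean_space set \<Rightarrow> ('a \<Rightarrow> 'b::real_normed_vector) \<Rightarrow> bool" where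
  "smooth_on S f \<longleftrightarrow> (\<forall>k. Ck_on k S f)"

text \<open>\<open>C\<^sup>1\<close> up to the boundary of the disc. Derivatives within \<^term>\<open>cball (0::complex) 1\<close> are
  unique, also at boundary points.\<close>

definition C1_closed_disc :: "(complex \<Rightarrow> complex \<times> complex) \<Rightarrow> bool" where
  "C1_closed_disc u \<longleftrightarrow>
     (\<exists>D :: complex \<Rightarrow> complex \<Rightarrow>\<^sub>L (complex \<times> complex).
        continuous_on (cball 0 1) D \<and>
        (\<forall>z\<in>cball 0 1. (u has_derivative blinfun_apply (D z)) (at z within cball 0 1)))"

definition lagrangian :: "(complex \<Rightarrow> complex \<times> complex) \<Rightarrow> bool" where
  "lagrangian u \<longleftrightarrow>
     (AE z in lborel. z \<in> ball 0 1 \<longrightarrow>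
        (\<forall>v w. symp_form (frechet_derivative u (at z) v) (frechet_derivative u (at z) w) = 0))"

text \<open>Since \<open>U\<close> is relatively open in the closed disc, \<^term>\<open>closure U - U\<close> is its relative
  boundary; near each of its points \<open>U\<close> is, inside the closed disc, a regular sublevel set of a
  smooth function. Near the remaining points of \<open>U\<close> on the unit circle, \<open>U\<close> coincides with the
  closed disc.\<close>

definition smooth_rel_domain :: "complex set \<Rightarrow> bool" where
  "smooth_rel_domain U \<longleftrightarrow>
     openin (top_of_set (cball 0 1)) U \<and> connected U \<and>
     (\<forall>z \<in> closure U - U. \<exists>W (\<rho> :: complex \<Rightarrow> real).
        open W \<and> z \<in> W \<and> smooth_on W \<rho> \<and> (\<forall>w\<in>W. grad \<rho> w \<noteq> 0) \<and>
        U \<inter> W = {w \<in> W \<inter> cball 0 1. \<rho> w < 0})"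

text \<open>The integrand \<open>\<langle>dX; du\<rangle> = \<Sum>\<^sub>k \<partial>\<^sub>kX \<cdot> \<partial>\<^sub>ku\<close>, with \<^term>\<open>Basis :: complex set\<close> equal to
  \<^term>\<open>{1, \<i>}\<close>.\<close>

definition diff_pairing ::
    "(complex \<Rightarrow> complex \<times> complex) \<Rightarrow> (complex \<Rightarrow> complex \<times> complex) \<Rightarrow> complex \<Rightarrow> real" where
  "diff_pairing X u z =
     (\<Sum>e\<in>Basis. frechet_derivative X (at z within cball 0 1) e \<bullet>
                  frechet_derivative u (at z within cball 0 1) e)"

text \<open>\<open>\<Omega>\<close> stands for an open set with smooth boundary and \<open>N\<close> for its outer normal, of which only
  the values on \<^term>\<open>frontier \<Omega>\<close> matter. The integrand is continuous on the closed disc, so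
  the integral is an ordinary Lebesgue integral; \<open>has_integral\<close> makes its existence part of the
  claim.\<close>

definition free_boundary_HSL_localization ::
    "(complex \<times> complex) set \<Rightarrow> (complex \<times> complex \<Rightarrow> complex \<times> complex) \<Rightarrow>
     (complex \<Rightarrow> complex \<times> complex) \<Rightarrow> bool" where
  "free_boundary_HSL_localization \<Omega> N u \<longleftrightarrow>
     C1_closed_disc u \<and> lagrangian u \<and> u ` sphere 0 1 \<subseteq> frontier \<Omega> \<and>
     (\<forall>U f. smooth_rel_domain U \<longrightarrow> smooth_on UNIV f \<longrightarrow>
        closure {x. f x \<noteq> 0} \<inter> u ` (frontier U \<inter> ball 0 1) = {} \<longrightarrow>
        (\<exists>V. openin (top_of_set (frontier \<Omega>)) V \<and> u ` (closure U \<inter> sphere 0 1) \<subseteq> V \<and>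
             (\<forall>x\<in>V. mult_I (grad f x) \<bullet> N x = 0)) \<longrightarrow>
        (diff_pairing (\<lambda>z. mult_I (grad f (u z))) u has_integral 0) U)"

definition Phi :: "nat \<Rightarrow> nat \<Rightarrow> complex \<Rightarrow> complex \<times> complex" where
  "Phi p q z =
     (cmod z powr sqrt (real p * real q) / sqrt (real p + real q)) *\<^sub>R
       (of_real (sqrt (real q)) * exp (\<i> * of_real (real p * Arg z)),
        \<i> * of_real (sqrt (real p)) * exp (- \<i> * of_real (real q * Arg z)))"

text \<open>The value does not depend on the choice of the angle.\<close>

lemma Phi_polar:
  assumes "r \<ge> 0"
  shows "Phi p q (of_real r * exp (\<i> * of_real \<theta>)) =
     (r powr sqrt (real p * real q) / sqrt (real p + real q)) *\<^sub>R
       (of_real (sqrt (real q)) * exp (\<i> * of_real (real p * \<theta>)),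
        \<i> * of_real (sqrt (real p)) * exp (- \<i> * of_real (real q * \<theta>)))"
proof (cases "r = 0")
  case True
  then show ?thesis by (simp add: Phi_def)
next
  case False
  define z where "z = of_real r * exp (\<i> * of_real \<theta>)"
  have n: "cmod z = r"
    using assms by (simp add: z_def norm_mult)
  have z0: "z \<noteq> 0" using False by (simp add: z_def)
  have "exp (\<i> * of_real (Arg z)) = sgn z"
    using cis_Arg[OF z0] by (simp add: cis_conv_exp)
  also have "\<dots> = exp (\<i> * of_real \<theta>)"
    using False assms by (simp add: sgn_div_norm n) (simp add: z_def scaleR_conv_of_real)
  finally have e: "exp (\<i> * of_real (Arg z)) = exp (\<i> * of_real \<theta>)" .
  have pos: "exp (\<i> * of_real (real m * t)) = exp (\<i> * of_real t) ^ m" for m t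
    by (simp add: exp_of_nat_mult[symmetric] mult_ac)
  have neg: "exp (- \<i> * of_real (real m * t)) = inverse (exp (\<i> * of_real t) ^ m)" for m t
    using pos[of m t] by (simp add: exp_minus)
  show ?thesis
    unfolding z_def[symmetric] by (simp only: Phi_def n pos neg e)
qed

end

theory Submission
  imports Defs
begin

text \<open>
  Write \<open>u\<close> for the map, \<open>s = \<surd>(p q)\<close>, \<open>X = I \<nabla>f \<circ> u\<close>, and let \<open>T v = (i p v\<^sub>1, - i q v\<^sub>2)\<close> generate the
  torus rotation that \<open>u\<close> follows. Since \<open>u\<close> is homogeneous of degree \<open>s\<close> and equivariant,
  \<open>r \<partial>\<^sub>r u = s u\<close> and \<open>\<partial>\<^sub>\<theta> u = T u\<close>; the Lagrangian condition is \<open>\<omega>(u, T u) = 0\<close>, that is,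
  \<open>p |u\<^sub>1|\<^sup>2 = q |u\<^sub>2|\<^sup>2\<close>.

  The map is harmonic only for \<open>p = q\<close>. In general \<open>r\<^sup>2 \<Delta>u = (s\<^sup>2 + T\<^sup>2) u = - (q - p) I T u\<close>, because
  \<open>s\<^sup>2 = p q\<close> (lemma \<open>spin_resonance\<close>). Pairing with \<open>X\<close> turns the defect into
  \<open>- (q - p) \<nabla>f \<cdot> T u = - (q - p) \<partial>\<^sub>\<theta> (f \<circ> u)\<close>, which is again a derivative. Hence with
  \<open>A = s X \<cdot> u\<close> and \<open>B = X \<cdot> T u + (q - p) (f \<circ> u)\<close>
  one has \<open>r\<^sup>2 \<langle>dX; du\<rangle> = r \<partial>\<^sub>r A + \<partial>\<^sub>\<theta> B\<close>,
  so the integrand is a divergence in the coordinates \<open>(ln r, \<theta>)\<close>. Its boundary terms vanish: near the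
  part of the boundary of \<open>U\<close> inside the disc, \<open>f \<circ> u\<close> vanishes identically; on the unit
  circle only \<open>A\<close> enters, and \<open>A\<close> is a multiple of \<open>I \<nabla>f \<cdot> N\<close> because the normal at \<open>u\<close> is
  \<open>u\<close>; at the origin \<open>A\<close> tends to \<open>0\<close> with \<open>u\<close>.

  The divergence theorem is obtained from translation invariance of Lebesgue measure, with a radial
  cutoff \<open>\<psi>\<^sub>n\<close> near the circle and the origin (lemma \<open>stokes_punctured_disc\<close>). Radiality makes
  \<open>\<partial>\<^sub>\<theta> \<psi>\<^sub>n = 0\<close>, so \<open>B\<close> leaves no error, and the error \<open>\<integral> r\<^sup>-\<^sup>2 A r \<partial>\<^sub>r \<psi>\<^sub>n\<close> is at most the
  supremum of \<open>|A|\<close> on the transition region times a constant.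
\<close>

section \<open>Integrals of directional derivatives\<close>

text \<open>The difference quotients of \<open>g\<close> have integral \<open>0\<close> by translation invariance, and they
  converge dominatedly to the directional derivative.\<close>

lemma integral_directional_derivative_eq_0:
  fixes g :: "'a::euclidean_space \<Rightarrow> real"
  assumes der: "\<And>x. (g has_derivative g' x) (at x)"
    and bound: "\<And>x. \<bar>g' x v\<bar> \<le> M"
    and supp: "\<And>x. norm x > R \<Longrightarrow> g x = 0"
  shows "has_bochner_integral lborel (\<lambda>x. g' x v) 0"
proof -
  define S where "S n x = real (Suc n) * (g (v /\<^sub>R real (Suc n) + x) - g x)" for n x
  have cont: "continuous_on UNIV g"
    using der by (meson continuous_at_imp_continuous_on has_derivative_continuous)
  then have meas [measurable]: "g \<in> borel_measurable borel"
    by (rule borel_measurable_continuous_onI)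
  have line: "((\<lambda>t. g (t *\<^sub>R v + x)) has_real_derivative g' (t *\<^sub>R v + x) v) (at t)" for t x
  proof -
    have "((\<lambda>t. g (t *\<^sub>R v + x)) has_derivative (\<lambda>h. g' (t *\<^sub>R v + x) (h *\<^sub>R v))) (at t)"
      by (rule has_derivative_compose[of "\<lambda>t. t *\<^sub>R v + x" "\<lambda>h. h *\<^sub>R v" t UNIV g, OF _ der])
        (auto intro!: derivative_eq_intros)
    moreover have "(\<lambda>h. g' (t *\<^sub>R v + x) (h *\<^sub>R v)) = (*) (g' (t *\<^sub>R v + x) v)"
      using has_derivative_linear[OF der] by (auto simp: linear_scale)
    ultimately show ?thesis
      by (simp add: has_field_derivative_def)
  qed
  have "integrable lborel (\<lambda>x. indicator (cball 0 R) x *\<^sub>R g x)"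
    by (rule borel_integrable_compact) (auto intro: continuous_on_subset[OF cont])
  moreover have "(\<lambda>x. indicator (cball 0 R) x *\<^sub>R g x) = g"
    using supp by (fastforce simp: indicator_def)
  ultimately have int: "integrable lborel g" by simp
  have "integrable (distr lborel borel ((+) a)) g" for a :: 'a
    using int by (simp add: lborel_distr_plus)
  then have int': "integrable lborel (\<lambda>x. g (a + x))" for a
    by (subst (asm) integrable_distr_eq) auto
  have "integral\<^sup>L (distr lborel borel ((+) a)) g = integral\<^sup>L lborel (\<lambda>x. g (a + x))" for a :: 'a
    by (subst integral_distr) auto
  then have tr: "integral\<^sup>L lborel (\<lambda>x. g (a + x)) = integral\<^sup>L lborel g" for a
    by (simp add: lborel_distr_plus)
  have S0: "integral\<^sup>L lborel (S n) = 0" for n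
    unfolding S_def using int int' tr by simp
  have Sm [measurable]: "S n \<in> borel_measurable lborel" for n
    unfolding S_def by measurable
  have lim: "(\<lambda>n. S n x) \<longlonglongrightarrow> g' x v" for x
  proof -
    have "(\<lambda>h. (g (h *\<^sub>R v + x) - g x) / h) \<midarrow>0\<rightarrow> g' x v"
      using line[of x 0] by (simp add: DERIV_def)
    moreover have "filterlim (\<lambda>n. inverse (real (Suc n))) (at 0) sequentially"
      using LIMSEQ_inverse_real_of_nat by (simp add: filterlim_at)
    ultimately have "(\<lambda>n. (g (inverse (real (Suc n)) *\<^sub>R v + x) - g x) / inverse (real (Suc n))) \<longlonglongrightarrow> g' x v"
      by (rule filterlim_compose)
    then show ?thesis
      unfolding S_def by (simp add: divide_inverse mult.commute)
  qed
  then have [measurable]: "(\<lambda>x. g' x v) \<in> borel_measurable lborel"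
    by (rule borel_measurable_LIMSEQ_real) simp
  have bd: "\<bar>S n x\<bar> \<le> indicator (cball 0 (R + norm v)) x *\<^sub>R M" for n x
  proof (cases "norm x \<le> R + norm v")
    case True
    let ?h = "inverse (real (Suc n))"
    obtain t where "g (?h *\<^sub>R v + x) - g (0 *\<^sub>R v + x) = (?h - 0) * g' (t *\<^sub>R v + x) v"
      using MVT2[of 0 ?h "\<lambda>t. g (t *\<^sub>R v + x)" "\<lambda>t. g' (t *\<^sub>R v + x) v"] line by auto
    then have "S n x = g' (t *\<^sub>R v + x) v"
      unfolding S_def by (simp add: field_simps del: of_nat_Suc)
    then show ?thesis using True bound by simp
  next
    case False
    have "norm (v /\<^sub>R real (Suc n)) \<le> norm v"
      by (simp add: field_simps)
    then have "norm (v /\<^sub>R real (Suc n) + x) > R"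
      using False norm_triangle_ineq2[of x "- (v /\<^sub>R real (Suc n))"] by (simp add: algebra_simps)
    moreover have "norm x > R" using False norm_ge_zero[of v] by linarith
    ultimately show ?thesis using False unfolding S_def by (simp add: supp)
  qed
  have w: "integrable lborel (\<lambda>x. indicator (cball 0 (R + norm v)) x *\<^sub>R M :: real)"
    by (rule borel_integrable_compact) auto
  have "integrable lborel (\<lambda>x. g' x v)"
    by (rule integrable_dominated_convergence[where s = S, OF _ _ w]) (use lim bd in auto)
  moreover have "(\<lambda>n. integral\<^sup>L lborel (S n)) \<longlonglongrightarrow> integral\<^sup>L lborel (\<lambda>x. g' x v)"
    by (rule integral_dominated_convergence[where s = S, OF _ _ w]) (use lim bd in auto)
  then have "integral\<^sup>L lborel (\<lambda>x. g' x v) = 0"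
    using S0 by (simp add: LIMSEQ_const_iff)
  ultimately show ?thesis by (simp add: has_bochner_integral_iff)
qed

text \<open>The vector field \<open>c z / |z|\<^sup>2 = c / cnj z\<close> is the conjugate of a holomorphic function, so by
  the Cauchy-Riemann equations it has divergence zero. For \<open>c = 1\<close> and \<open>c = i\<close> the integrand is
  \<open>r\<^sup>-\<^sup>2\<close> times the radial derivative \<open>r \<partial>\<^sub>r P\<close> and the angular derivative \<open>\<partial>\<^sub>\<theta> P\<close>.\<close>

lemma integral_spiral_derivative_eq_0:
  fixes P :: "complex \<Rightarrow> real" and c :: complex
  assumes der: "\<And>z. (P has_derivative P' z) (at z)"
    and bound: "\<And>z. \<bar>P z\<bar> \<le> M" "\<And>z h. \<bar>P' z h\<bar> \<le> M * norm h"
    and \<delta>: "\<delta> > 0" and inner: "\<And>z. norm z < \<delta> \<Longrightarrow> P z = 0"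
    and outer: "\<And>z. norm z > R \<Longrightarrow> P z = 0"
  shows "has_bochner_integral lborel (\<lambda>z. P' z (c * z) / (norm z)\<^sup>2) 0"
proof -
  \<comment> \<open>The field is \<open>cnj (w z)\<close>, with components \<open>Re (w z)\<close> and \<open>- Im (w z)\<close>.\<close>
  define w where "w z = cnj c / z" for z
  define w' where "w' z = - cnj c / z\<^sup>2" for z
  have inner': "P' z h = 0" if "norm z < \<delta>" for z h
  proof -
    have "((\<lambda>z. 0) has_derivative P' z) (at z)"
    proof (rule has_derivative_transform_within_open[OF der])
      show "open (ball 0 \<delta> :: complex set)" "z \<in> ball 0 \<delta>" using that by auto
    qed (use inner in auto)
    then have "P' z = (\<lambda>h. 0)"
      using has_derivative_unique has_derivative_const by blast
    then show ?thesis by simp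
  qed
  have linP: "linear (P' z)" for z using has_derivative_linear[OF der] .
  have M0: "M \<ge> 0" using bound(1)[of 0] by linarith
  have wd: "(w has_derivative (\<lambda>h. w' z * h)) (at z)" if "z \<noteq> 0" for z
    unfolding w_def w'_def has_field_derivative_def[symmetric] using that
    by (auto intro!: derivative_eq_intros simp: power2_eq_square)
  have wb: "norm (w z) \<le> norm c / \<delta>" "norm (w' z) \<le> norm c / \<delta>\<^sup>2" if "norm z \<ge> \<delta>" for z
    using that \<delta> by (auto simp: w_def w'_def norm_divide norm_power intro!: divide_left_mono power_mono mult_pos_pos)
  define K where "K = M * (norm c / \<delta>) + M * (norm c / \<delta>\<^sup>2)"
  have main: "has_bochner_integral lborel (\<lambda>z. P' z e * L (w z) + P z * L (w' z * e)) 0"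
    if L: "bounded_linear L" "\<And>x. \<bar>L x\<bar> \<le> norm x" and e: "norm e = 1"
    for L :: "complex \<Rightarrow> real" and e
  proof (rule integral_directional_derivative_eq_0[where R = R])
    fix z
    show "((\<lambda>z. P z * L (w z)) has_derivative (\<lambda>h. P' z h * L (w z) + P z * L (w' z * h))) (at z)"
    proof (cases "norm z < \<delta>")
      case True
      have "((\<lambda>z. P z * L (w z)) has_derivative (\<lambda>h. 0)) (at z)"
      proof (rule has_derivative_transform_within_open[OF has_derivative_const])
        show "open (ball 0 \<delta> :: complex set)" "z \<in> ball 0 \<delta>" using True by auto
      qed (use inner in auto)
      then show ?thesis using True inner inner' by simp
    next
      case False
      then have "z \<noteq> 0" using \<delta> by auto
      have "((\<lambda>z. L (w z)) has_derivative (\<lambda>h. L (w' z * h))) (at z)"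
        by (rule bounded_linear.has_derivative[OF L(1) wd[OF \<open>z \<noteq> 0\<close>]])
      from has_derivative_mult[OF der this] show ?thesis
        by (simp add: algebra_simps)
    qed
    show "\<bar>P' z e * L (w z) + P z * L (w' z * e)\<bar> \<le> K"
    proof (cases "norm z < \<delta>")
      case True
      then show ?thesis using inner inner' \<delta> M0 by (simp add: K_def)
    next
      case False
      have "\<bar>P' z e * L (w z)\<bar> \<le> M * (norm c / \<delta>)"
        unfolding abs_mult using bound(2)[of z e] e L(2)[of "w z"] wb(1)[of z] False M0
        by (intro mult_mono) auto
      moreover have "\<bar>P z * L (w' z * e)\<bar> \<le> M * (norm c / \<delta>\<^sup>2)"
        unfolding abs_mult using bound(1)[of z] e L(2)[of "w' z * e"] wb(2)[of z] False M0
        by (intro mult_mono) (auto simp: norm_mult)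
      ultimately show ?thesis unfolding K_def by linarith
    qed
    show "P z * L (w z) = 0" if "norm z > R" using outer that by simp
  qed
  have 1: "has_bochner_integral lborel (\<lambda>z. P' z 1 * Re (w z) + P z * Re (w' z * 1)) 0"
    by (rule main) (auto intro: bounded_linear_Re abs_Re_le_cmod)
  have 2: "has_bochner_integral lborel (\<lambda>z. P' z \<i> * Im (w z) + P z * Im (w' z * \<i>)) 0"
    by (rule main) (auto intro: bounded_linear_Im abs_Im_le_cmod)
  have "P' z (c * z) / (norm z)\<^sup>2 =
     (P' z 1 * Re (w z) + P z * Re (w' z * 1)) - (P' z \<i> * Im (w z) + P z * Im (w' z * \<i>))" for z
  proof (cases "z = 0")
    case True
    then show ?thesis using inner'[of 0] inner[of 0] \<delta> by simp
  next
    case False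
    have "c * z /\<^sub>R (norm z)\<^sup>2 = cnj (w z)"
      using False complex_norm_square[of z]
      by (simp add: w_def scaleR_conv_of_real field_simps)
    also have "\<dots> = Re (w z) *\<^sub>R 1 + (- Im (w z)) *\<^sub>R \<i>"
      by (simp add: complex_eq_iff)
    finally have "P' z (c * z /\<^sub>R (norm z)\<^sup>2) = Re (w z) * P' z 1 + (- Im (w z)) * P' z \<i>"
      using linP[of z] by (simp only: linear_add linear_scale real_scaleR_def)
    then show ?thesis using linP[of z]
      by (simp add: linear_scale divide_inverse mult.commute)
  qed
  then show ?thesis using has_bochner_integral_diff[OF 1 2] by simp
qed

section \<open>Cutting off near the circle and the origin\<close>

lemma has_derivative_zero_extension:
  fixes G :: "'a::real_normed_vector \<Rightarrow> 'b::real_normed_vector"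
  assumes "open V"
    and der: "\<And>z. z \<in> V \<Longrightarrow> (G has_derivative G' z) (at z)"
    and fr: "\<And>z. z \<in> frontier V \<Longrightarrow> \<forall>\<^sub>F w in nhds z. w \<in> V \<longrightarrow> G w = 0"
  shows "((\<lambda>z. if z \<in> V then G z else 0) has_derivative (\<lambda>h. if z \<in> V then G' z h else 0)) (at z)"
proof (cases "z \<in> V")
  case True
  have "((\<lambda>z. if z \<in> V then G z else 0) has_derivative G' z) (at z)"
    by (rule has_derivative_transform_within_open[OF der[OF True] \<open>open V\<close> True]) simp
  then show ?thesis using True by simp
next
  case False
  have "\<forall>\<^sub>F w in nhds z. (if w \<in> V then G w else 0) = 0"
  proof (cases "z \<in> closure V")
    case True
    then have "z \<in> frontier V" using False \<open>open V\<close> by (simp add: frontier_def interior_open)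
    from fr[OF this] show ?thesis by (rule eventually_mono) auto
  next
    case out: False
    then have "\<forall>\<^sub>F w in nhds z. w \<in> - closure V"
      by (intro eventually_nhds_in_open) auto
    then show ?thesis
      by (rule eventually_mono) (use closure_subset in auto)
  qed
  then obtain S where S: "open S" "z \<in> S" "\<And>w. w \<in> S \<Longrightarrow> (if w \<in> V then G w else 0) = 0"
    unfolding eventually_nhds by blast
  have "((\<lambda>z. if z \<in> V then G z else 0) has_derivative (\<lambda>h. 0)) (at z)"
    by (rule has_derivative_transform_within_open[OF has_derivative_const S(1,2)]) (use S(3) in auto)
  then show ?thesis using False by simp
qed

text \<open>A continuously differentiable step from \<open>0\<close> to \<open>1\<close> over the unit interval: its derivative is
  the tent function with peak \<open>2\<close> at \<open>1/2\<close>.\<close>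

definition ramp :: "real \<Rightarrow> real" where
  "ramp t = 2 * (max 0 t)\<^sup>2 - 4 * (max 0 (t - 1/2))\<^sup>2 + 2 * (max 0 (t - 1))\<^sup>2"

definition ramp' :: "real \<Rightarrow> real" where
  "ramp' t = 4 * max 0 t - 8 * max 0 (t - 1/2) + 4 * max 0 (t - 1)"

lemma DERIV_max_square: "((\<lambda>t::real. (max 0 t)\<^sup>2) has_real_derivative 2 * max 0 t) (at t)"
proof (cases t "0::real" rule: linorder_cases)
  case less
  have "((\<lambda>t::real. (max 0 t)\<^sup>2) has_real_derivative 0) (at t)"
    by (rule has_field_derivative_transform_within_open[of "\<lambda>_. 0" _ _ "{..<0}"]) (use less in auto)
  then show ?thesis using less by simp
next
  case equal
  have "(\<lambda>h::real. (max 0 h)\<^sup>2 / h) \<midarrow>0\<rightarrow> 0"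
    by (rule Lim_null_comparison[where g = "\<lambda>h. \<bar>h\<bar>"])
      (auto intro!: tendsto_eq_intros always_eventually simp: max_def power2_eq_square)
  then show ?thesis using equal by (simp add: DERIV_def)
next
  case greater
  have "((\<lambda>t::real. (max 0 t)\<^sup>2) has_real_derivative 2 * t) (at t)"
    by (rule has_field_derivative_transform_within_open[of "\<lambda>t. t\<^sup>2" _ _ "{0<..}"])
      (use greater in \<open>auto intro!: derivative_eq_intros\<close>)
  then show ?thesis using greater by simp
qed

lemma DERIV_ramp: "(ramp has_real_derivative ramp' t) (at t)"
proof -
  have shift: "((\<lambda>t::real. (max 0 (t - c))\<^sup>2) has_real_derivative 2 * max 0 (t - c)) (at t)" for c
    using DERIV_chain2[of "\<lambda>t. (max 0 t)\<^sup>2" _ "\<lambda>t. t - c" t 1 UNIV, OF DERIV_max_square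
        DERIV_diff[OF DERIV_ident DERIV_const, simplified]]
    by simp
  show ?thesis
    unfolding ramp_def[abs_def] ramp'_def
    using DERIV_add[OF DERIV_diff[OF DERIV_cmult[OF DERIV_max_square, of 2]
      DERIV_cmult[OF shift[of "1/2"], of 4]] DERIV_cmult[OF shift[of 1], of 2]]
    by simp
qed

lemma ramp_eq_0: "t \<le> 0 \<Longrightarrow> ramp t = 0"
  by (simp add: ramp_def)

lemma ramp_eq_1: "t \<ge> 1 \<Longrightarrow> ramp t = 1"
  by (simp add: ramp_def power2_eq_square algebra_simps)

lemma ramp'_eq_0: "t \<le> 0 \<or> t \<ge> 1 \<Longrightarrow> ramp' t = 0"
  by (auto simp: ramp'_def max_def)

lemma ramp'_bound: "0 \<le> ramp' t" "ramp' t \<le> 2"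
  by (auto simp: ramp'_def max_def)

lemma ramp_bound: "\<bar>ramp t\<bar> \<le> 1"
proof -
  have mono: "ramp a \<le> ramp b" if "a \<le> b" for a b
    by (rule DERIV_nonneg_imp_nondecreasing[OF that]) (use DERIV_ramp ramp'_bound(1) in blast)
  have "ramp (min 0 t) \<le> ramp t" "ramp t \<le> ramp (max 1 t)"
    by (rule mono; simp)+
  then show ?thesis by (simp add: ramp_eq_0 ramp_eq_1)
qed

section \<open>A divergence theorem in logarithmic polar coordinates\<close>

text \<open>The equation for \<open>J\<close> says \<open>J = r\<^sup>-\<^sup>2 (r \<partial>\<^sub>r A + \<partial>\<^sub>\<theta> B)\<close>. Cut both functions off by
  \<open>\<psi>\<^sub>n = ramp (n \<tau> - 1)\<close> with \<open>\<tau> = r\<^sup>2 (1 - r\<^sup>2)\<close>, which vanishes near the origin and the circle and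
  tends to \<open>1\<close> on \<open>W\<close>. The products, extended by zero, are differentiable on the plane, so
  \<open>\<integral> \<psi>\<^sub>n J = - \<integral> r\<^sup>-\<^sup>2 A r \<partial>\<^sub>r \<psi>\<^sub>n\<close>. The right-hand integrand is at most \<open>4 n |A|\<close> and lives where
  \<open>\<tau> < 2 / n\<close>, a set of area at most \<open>8 \<pi> / n\<close> on which \<open>A\<close> is uniformly small.\<close>

lemma stokes_punctured_disc:
  fixes A B J :: "complex \<Rightarrow> real"
  assumes W: "open W" "W \<subseteq> ball 0 1 - {0}"
    and derA: "\<And>z. z \<in> W \<Longrightarrow> (A has_derivative A' z) (at z)"
    and derB: "\<And>z. z \<in> W \<Longrightarrow> (B has_derivative B' z) (at z)"
    and bdA: "\<And>z. z \<in> W \<Longrightarrow> \<bar>A z\<bar> \<le> M" "\<And>z h. z \<in> W \<Longrightarrow> \<bar>A' z h\<bar> \<le> M * norm h"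
    and bdB: "\<And>z. z \<in> W \<Longrightarrow> \<bar>B z\<bar> \<le> M" "\<And>z h. z \<in> W \<Longrightarrow> \<bar>B' z h\<bar> \<le> M * norm h"
    and vanish: "\<And>z. z \<in> frontier W \<Longrightarrow> z \<noteq> 0 \<Longrightarrow> norm z < 1 \<Longrightarrow>
                   \<forall>\<^sub>F w in nhds z. w \<in> W \<longrightarrow> A w = 0 \<and> B w = 0"
    and small: "\<And>e. e > 0 \<Longrightarrow> \<exists>d>0. \<forall>z\<in>W. (norm z)\<^sup>2 * (1 - (norm z)\<^sup>2) < d \<longrightarrow> \<bar>A z\<bar> \<le> e"
    and J: "\<And>z. z \<in> W \<Longrightarrow> J z * (norm z)\<^sup>2 = A' z z + B' z (\<i> * z)"
    and contJ: "continuous_on W J" and bdJ: "\<And>z. z \<in> W \<Longrightarrow> \<bar>J z\<bar> \<le> M"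
  shows "(J has_integral 0) W"
proof -
  define \<rho> where "\<rho> z = (norm z)\<^sup>2" for z :: complex
  define \<tau> where "\<tau> z = \<rho> z * (1 - \<rho> z)" for z
  define \<psi> where "\<psi> n z = ramp (real (Suc n) * \<tau> z - 1)" for n z
  define \<psi>' where "\<psi>' n z h =
    ramp' (real (Suc n) * \<tau> z - 1) * (real (Suc n) * ((1 - 2 * \<rho> z) * (2 * (z \<bullet> h))))" for n z h
  have W\<rho>: "0 < \<rho> z" "\<rho> z < 1" if "z \<in> W" for z
    using that W(2) by (auto simp: \<rho>_def abs_square_less_1)
  have der\<rho>: "(\<rho> has_derivative (\<lambda>h. 2 * (z \<bullet> h))) (at z)" for z
    unfolding \<rho>_def dot_square_norm[symmetric]
    by (auto intro!: derivative_eq_intros simp: inner_commute)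
  have der\<psi>: "(\<psi> n has_derivative \<psi>' n z) (at z)" for n z
  proof -
    have "((\<lambda>z. real (Suc n) * \<tau> z - 1) has_derivative
            (\<lambda>h. real (Suc n) * ((1 - 2 * \<rho> z) * (2 * (z \<bullet> h))))) (at z)"
      unfolding \<tau>_def
      by (rule der\<rho> derivative_eq_intros refl | simp add: algebra_simps del: of_nat_Suc)+
    from has_derivative_compose[OF this DERIV_ramp[unfolded has_field_derivative_def]]
    show ?thesis unfolding \<psi>_def \<psi>'_def .
  qed
  have M0: "M \<ge> 0" if "z \<in> W" for z using bdJ[OF that] by linarith
  have \<psi>0: "\<psi> n z = 0" if "\<tau> z \<le> 1 / real (Suc n)" for n z
    unfolding \<psi>_def using that by (intro ramp_eq_0) (simp add: field_simps)
  have \<psi>1: "\<bar>\<psi> n z\<bar> \<le> 1" for n z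
    unfolding \<psi>_def by (rule ramp_bound)
  have \<psi>'b: "\<bar>\<psi>' n z h\<bar> \<le> 4 * real (Suc n) * norm h" if "z \<in> W" for n z h
  proof -
    have "\<bar>z \<bullet> h\<bar> \<le> 1 * norm h"
      using Cauchy_Schwarz_ineq2[of z h] W(2) that
      by (intro order_trans[OF Cauchy_Schwarz_ineq2] mult_right_mono) auto
    moreover have "\<bar>1 - 2 * \<rho> z\<bar> \<le> 1" using W\<rho>[OF that] by auto
    ultimately have "\<bar>(1 - 2 * \<rho> z) * (2 * (z \<bullet> h))\<bar> \<le> 1 * (2 * norm h)"
      unfolding abs_mult by (intro mult_mono) auto
    then have "\<bar>ramp' (real (Suc n) * \<tau> z - 1)\<bar> * (real (Suc n) * \<bar>(1 - 2 * \<rho> z) * (2 * (z \<bullet> h))\<bar>)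
        \<le> 2 * (real (Suc n) * (1 * (2 * norm h)))"
      by (intro mult_mono mult_left_mono) (use ramp'_bound[of "real (Suc n) * \<tau> z - 1"] in auto)
    also have "\<dots> = 4 * real (Suc n) * norm h" by simp
    finally show ?thesis unfolding \<psi>'_def by (simp add: abs_mult del: of_nat_Suc)
  qed
  have cut: "has_bochner_integral lborel
      (\<lambda>z. (if z \<in> W then \<psi>' n z (c * z) * G z + \<psi> n z * G' z (c * z) else 0) / (norm z)\<^sup>2) 0"
    if derG: "\<And>z. z \<in> W \<Longrightarrow> (G has_derivative G' z) (at z)"
      and bdG: "\<And>z. z \<in> W \<Longrightarrow> \<bar>G z\<bar> \<le> M" "\<And>z h. z \<in> W \<Longrightarrow> \<bar>G' z h\<bar> \<le> M * norm h"
      and vanG: "\<And>z. z \<in> frontier W \<Longrightarrow> z \<noteq> 0 \<Longrightarrow> norm z < 1 \<Longrightarrow> \<forall>\<^sub>F w in nhds z. w \<in> W \<longrightarrow> G w = 0"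
    for n G G' c
  proof -
    let ?P = "\<lambda>z. if z \<in> W then \<psi> n z * G z else 0"
    let ?P' = "\<lambda>z h. if z \<in> W then \<psi>' n z h * G z + \<psi> n z * G' z h else 0"
    let ?K = "\<bar>M\<bar> * (4 * real (Suc n) + 1)"
    show ?thesis
    proof (rule integral_spiral_derivative_eq_0[where P = ?P and P' = ?P' and M = ?K and R = 1
          and \<delta> = "sqrt (1 / real (Suc n))"])
      fix z
      show "(?P has_derivative ?P' z) (at z)"
      proof (rule has_derivative_zero_extension[OF W(1)])
        fix z assume "z \<in> W"
        from has_derivative_mult[OF der\<psi> derG[OF this]]
        show "((\<lambda>z. \<psi> n z * G z) has_derivative (\<lambda>h. \<psi>' n z h * G z + \<psi> n z * G' z h)) (at z)"
          by (simp add: algebra_simps)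
      next
        fix z assume z: "z \<in> frontier W"
        show "\<forall>\<^sub>F w in nhds z. w \<in> W \<longrightarrow> \<psi> n w * G w = 0"
        proof (cases "z = 0 \<or> norm z \<ge> 1")
          case True
          then have "\<tau> z < 1 / real (Suc n)"
          proof
            assume "norm z \<ge> 1"
            then have "\<tau> z \<le> 0"
              using one_le_power[of "norm z" 2] unfolding \<tau>_def \<rho>_def by (intro mult_nonneg_nonpos) auto
            also have "0 < 1 / real (Suc n)" by simp
            finally show ?thesis .
          qed (simp add: \<tau>_def \<rho>_def)
          moreover have "isCont \<tau> z"
            unfolding \<tau>_def \<rho>_def by (intro continuous_intros)
          ultimately have "\<forall>\<^sub>F w in nhds z. \<tau> w < 1 / real (Suc n)"
            by (metis continuous_within order_tendstoD(2) tendsto_at_iff_tendsto_nhds)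
          then show ?thesis
            by (rule eventually_mono) (use \<psi>0 in \<open>auto simp: less_imp_le\<close>)
        next
          case False
          with vanG[OF z] show ?thesis by (auto elim!: eventually_mono)
        qed
      qed
      show "\<bar>?P z\<bar> \<le> ?K"
      proof (cases "z \<in> W")
        case True
        have "\<bar>\<psi> n z * G z\<bar> \<le> 1 * \<bar>M\<bar>"
          unfolding abs_mult using \<psi>1 bdG(1)[OF True] by (intro mult_mono) auto
        also have "\<dots> \<le> ?K" by (simp add: algebra_simps)
        finally show ?thesis using True by simp
      qed auto
      show "\<bar>?P' z h\<bar> \<le> ?K * norm h" for h
      proof (cases "z \<in> W")
        case True
        have "\<bar>\<psi>' n z h * G z\<bar> \<le> (4 * real (Suc n) * norm h) * \<bar>M\<bar>"
          unfolding abs_mult using \<psi>'b[OF True, of n h] bdG(1)[OF True] by (intro mult_mono) auto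
        moreover have "\<bar>\<psi> n z * G' z h\<bar> \<le> 1 * (\<bar>M\<bar> * norm h)"
          unfolding abs_mult using \<psi>1 bdG(2)[OF True, of h] M0[OF True] by (intro mult_mono) auto
        ultimately have "\<bar>\<psi>' n z h * G z + \<psi> n z * G' z h\<bar> \<le> (4 * real (Suc n) * norm h) * \<bar>M\<bar> + 1 * (\<bar>M\<bar> * norm h)"
          by linarith
        then show ?thesis using True by (simp add: algebra_simps)
      qed auto
      show "sqrt (1 / real (Suc n)) > 0" by simp
      show "?P z = 0" if "norm z < sqrt (1 / real (Suc n))"
      proof -
        have "(norm z)\<^sup>2 < (sqrt (1 / real (Suc n)))\<^sup>2"
          using that by (intro power_strict_mono) auto
        then have "\<rho> z < 1 / real (Suc n)" unfolding \<rho>_def by simp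
        moreover have "\<tau> z \<le> \<rho> z" unfolding \<tau>_def \<rho>_def by (simp add: algebra_simps)
        ultimately show ?thesis using \<psi>0[of z n] by simp
      qed
      show "?P z = 0" if "norm z > 1" using that W(2) by auto
    qed
  qed
  have rot: "\<psi>' n z (\<i> * z) = 0" for n z
    by (simp add: \<psi>'_def inner_complex_def)
  have rad: "\<psi>' n z z = 2 * real (Suc n) * ramp' (real (Suc n) * \<tau> z - 1) * (1 - 2 * \<rho> z) * (norm z)\<^sup>2" for n z
    by (simp add: \<psi>'_def dot_square_norm)
  \<comment> \<open>\<open>E n\<close> is the error term, in which the factor \<open>r\<^sup>-\<^sup>2\<close> has cancelled against \<open>r \<partial>\<^sub>r \<psi>\<^sub>n\<close>, and
    \<open>S n\<close> is the cut-off integrand.\<close>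
  define E where "E n z = (if z \<in> W then
      2 * real (Suc n) * ramp' (real (Suc n) * \<tau> z - 1) * (1 - 2 * \<rho> z) * A z else 0)" for n z
  define S where "S n z = (if z \<in> W then \<psi> n z * J z else 0)" for n z
  have tot: "has_bochner_integral lborel (\<lambda>z. E n z + S n z) 0" for n
  proof -
    have *: "has_bochner_integral lborel (\<lambda>z.
       (if z \<in> W then \<psi>' n z (1 * z) * A z + \<psi> n z * A' z (1 * z) else 0) / (norm z)\<^sup>2 +
       (if z \<in> W then \<psi>' n z (\<i> * z) * B z + \<psi> n z * B' z (\<i> * z) else 0) / (norm z)\<^sup>2) (0 + 0)"
      by (intro has_bochner_integral_add cut derA derB bdA bdB)
        (auto dest!: vanish elim!: eventually_mono)
    have "(if z \<in> W then \<psi>' n z (1 * z) * A z + \<psi> n z * A' z (1 * z) else 0) / (norm z)\<^sup>2 +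
       (if z \<in> W then \<psi>' n z (\<i> * z) * B z + \<psi> n z * B' z (\<i> * z) else 0) / (norm z)\<^sup>2
       = E n z + S n z" for z
    proof (cases "z \<in> W")
      case True
      then have "z \<noteq> 0" using W(2) by auto
      have "\<psi>' n z z * A z + \<psi> n z * A' z z + \<psi> n z * B' z (\<i> * z) =
        (2 * real (Suc n) * ramp' (real (Suc n) * \<tau> z - 1) * (1 - 2 * \<rho> z) * A z + \<psi> n z * J z) * (norm z)\<^sup>2"
        unfolding rad eq_diff_eq[THEN iffD2, OF J[OF True, symmetric]]
        by (simp add: algebra_simps del: of_nat_Suc)
      then show ?thesis using True \<open>z \<noteq> 0\<close>
        unfolding E_def S_def by (simp add: rot add_divide_distrib[symmetric] del: of_nat_Suc)
    qed (simp add: E_def S_def)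
    then show ?thesis using * by simp
  qed
  have Wm [measurable]: "W \<in> sets borel" using W(1) by simp
  have Jm: "(\<lambda>z. if z \<in> W then J z else 0) \<in> borel_measurable lborel"
  proof -
    have "(\<lambda>z. if z \<in> W then J z else 0) = (\<lambda>z. indicator W z *\<^sub>R J z)" by auto
    then show ?thesis using borel_measurable_continuous_on_indicator[OF Wm contJ] by simp
  qed
  have \<psi>m [measurable]: "\<psi> n \<in> borel_measurable borel" for n
    by (intro borel_measurable_continuous_onI continuous_at_imp_continuous_on)
      (use der\<psi> has_derivative_continuous in blast)
  have S_eq: "S n = (\<lambda>z. \<psi> n z * (if z \<in> W then J z else 0))" for n
    by (auto simp: S_def)
  have Sm: "S n \<in> borel_measurable lborel" for n
    unfolding S_eq using Jm by measurable
  have lim: "(\<lambda>n. S n z) \<longlonglongrightarrow> (if z \<in> W then J z else 0)" for z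
  proof (cases "z \<in> W")
    case True
    have "\<tau> z > 0" unfolding \<tau>_def using W\<rho>[OF True] by simp
    obtain N where N: "2 / \<tau> z < real N" using reals_Archimedean2 by blast
    have "\<psi> n z = 1" if "n \<ge> N" for n
    proof -
      have "2 / \<tau> z < real (Suc n)" using N that by simp
      then show ?thesis unfolding \<psi>_def using \<open>\<tau> z > 0\<close>
        by (intro ramp_eq_1) (simp add: field_simps)
    qed
    then have "\<forall>\<^sub>F n in sequentially. S n z = J z"
      unfolding S_def using True by (auto simp: eventually_sequentially)
    then show ?thesis using True by (simp add: tendsto_eventually)
  qed (simp add: S_def)
  have w: "integrable lborel (\<lambda>x. indicator (cball 0 1 :: complex set) x *\<^sub>R \<bar>M\<bar>)"
    by (rule borel_integrable_compact) auto
  have bdS: "\<bar>S n z\<bar> \<le> indicator (cball 0 1) z *\<^sub>R \<bar>M\<bar>" for n z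
  proof (cases "z \<in> W")
    case True
    have "\<bar>\<psi> n z * J z\<bar> \<le> 1 * \<bar>M\<bar>"
      unfolding abs_mult using \<psi>1 bdJ[OF True] by (intro mult_mono) auto
    then show ?thesis using True W(2) by (auto simp: S_def)
  next
    case False
    then show ?thesis by (simp add: S_def)
  qed
  have intJ: "integrable lborel (\<lambda>z. if z \<in> W then J z else 0)"
    by (rule integrable_dominated_convergence[where s = S, OF Jm Sm w]) (use lim bdS in auto)
  have conv: "(\<lambda>n. integral\<^sup>L lborel (S n)) \<longlonglongrightarrow> integral\<^sup>L lborel (\<lambda>z. if z \<in> W then J z else 0)"
    by (rule integral_dominated_convergence[where s = S, OF Jm Sm w]) (use lim bdS in auto)
  have intS: "integrable lborel (S n)" for n
    by (rule Bochner_Integration.integrable_bound[OF w Sm])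
      (use bdS in \<open>auto intro!: always_eventually intro: order_trans[OF _ abs_ge_self]\<close>)
  have intE: "integrable lborel (E n)" for n
    using Bochner_Integration.integrable_diff[OF integrable.intros[OF tot[of n]] intS[of n]] by simp
  have SE: "integral\<^sup>L lborel (S n) = - integral\<^sup>L lborel (E n)" for n
    using has_bochner_integral_integral_eq[OF tot[of n]] intE[of n] intS[of n] by simp
  have "(\<lambda>n. integral\<^sup>L lborel (S n)) \<longlonglongrightarrow> 0"
  proof (rule LIMSEQ_I)
    fix r :: real assume r: "r > 0"
    \<comment> \<open>Half of \<open>r\<close> divided by \<open>32 \<pi> = 4 m * 8 \<pi> / m\<close>, the bound for the error at \<open>|A| \<le> 1\<close>.\<close>
    define e where "e = r / (64 * pi)"
    have e: "e > 0" using r by (simp add: e_def)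
    obtain d where d: "d > 0" "\<And>z. z \<in> W \<Longrightarrow> \<tau> z < d \<Longrightarrow> \<bar>A z\<bar> \<le> e"
      using small[OF e] unfolding \<tau>_def \<rho>_def by blast
    obtain N where N: "max 4 (2 / d) < real N" using reals_Archimedean2 by blast
    have "\<bar>integral\<^sup>L lborel (S n)\<bar> < r" if "n \<ge> N" for n
    proof -
      define m where "m = real (Suc n)"
      have m: "m > 4" "2 / d < m" unfolding m_def using N that by auto
      have "2 / m < d" using m d by (simp add: field_simps)
      \<comment> \<open>Where \<open>\<tau> < 2 / m\<close>, either \<open>r\<^sup>2 \<le> 4 / m\<close> or \<open>1 - r\<^sup>2 \<le> 4 / m\<close>: a small disc and a thin annulus,
        each of area \<open>4 \<pi> / m\<close>.\<close>
      let ?b = "\<lambda>z::complex. 4 * m * e * (indicator (cball 0 (2 / sqrt m)) z +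
          (indicator (cball 0 1) z - indicator (ball 0 (sqrt (1 - 4 / m))) z)) :: real"
      have sub: "ball 0 (sqrt (1 - 4 / m)) \<subseteq> (cball 0 1 :: complex set)"
        using m by (intro order_trans[OF ball_subset_cball] subset_cball) simp
      have b0: "?b z \<ge> 0" for z
        using m e sub by (intro mult_nonneg_nonneg) (auto simp: indicator_def)
      have Eb: "\<bar>E n z\<bar> \<le> ?b z" for z
      proof (cases "z \<in> W \<and> m * \<tau> z < 2")
        case False
        then have "E n z = 0"
          unfolding E_def m_def[symmetric] by (auto intro!: ramp'_eq_0)
        then show ?thesis using b0 by simp
      next
        case True
        then have z: "z \<in> W" "\<tau> z < 2 / m" using m by (auto simp: field_simps)
        have A: "\<bar>A z\<bar> \<le> e" using d(2)[of z] z \<open>2 / m < d\<close> by simp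
        have "\<bar>2 * m * ramp' (m * \<tau> z - 1) * (1 - 2 * \<rho> z) * A z\<bar> \<le> 2 * m * 2 * 1 * e"
          unfolding abs_mult using ramp'_bound[of "m * \<tau> z - 1"] W\<rho>[OF z(1)] A m
          by (intro mult_mono) auto
        then have 1: "\<bar>E n z\<bar> \<le> 4 * m * e"
          using z(1) unfolding E_def m_def[symmetric] by simp
        have "z \<in> cball 0 (2 / sqrt m) \<or> z \<notin> ball 0 (sqrt (1 - 4 / m))"
        proof (cases "\<rho> z \<le> 1 / 2")
          case True
          have "\<rho> z * (1 / 2) \<le> \<tau> z"
            unfolding \<tau>_def using True W\<rho>[OF z(1)] by (intro mult_left_mono) auto
          then have "(norm z)\<^sup>2 \<le> (2 / sqrt m)\<^sup>2"
            using z(2) m unfolding \<rho>_def by (simp add: power_divide)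
          then show ?thesis using m by (auto dest!: power2_le_imp_le)
        next
          case False
          have "(1 / 2) * (1 - \<rho> z) \<le> \<tau> z"
            unfolding \<tau>_def using False W\<rho>[OF z(1)] by (intro mult_right_mono) auto
          then have "(sqrt (1 - 4 / m))\<^sup>2 \<le> (norm z)\<^sup>2"
            using z(2) m unfolding \<rho>_def by simp
          then show ?thesis by (auto dest!: power2_le_imp_le)
        qed
        moreover have "z \<in> cball 0 1" using z(1) W(2) by auto
        ultimately have "4 * m * e * 1 \<le> ?b z"
          using m e sub by (intro mult_left_mono) (auto simp: indicator_def)
        then show ?thesis using 1 by simp
      qed
      have hb: "has_bochner_integral lborel ?b (4 * m * e * (measure lborel (cball (0::complex) (2 / sqrt m)) +
          (measure lborel (cball (0::complex) 1) - measure lborel (ball (0::complex) (sqrt (1 - 4 / m))))))"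
        by (intro has_bochner_integral_mult_right has_bochner_integral_add has_bochner_integral_diff
            has_bochner_integral_real_indicator emeasure_lborel_ball_finite emeasure_lborel_cball_finite) simp_all
      have "norm (integral\<^sup>L lborel (E n)) \<le> integral\<^sup>L lborel ?b"
        by (rule Bochner_Integration.integral_norm_bound_integral[OF intE integrable.intros[OF hb]])
          (use Eb in simp)
      also have "\<dots> = 4 * m * e * (measure lborel (cball (0::complex) (2 / sqrt m)) +
          (measure lborel (cball (0::complex) 1) - measure lborel (ball (0::complex) (sqrt (1 - 4 / m)))))"
        by (rule has_bochner_integral_integral_eq[OF hb])
      also have "\<dots> = 32 * pi * e"
        using m by (simp add: content_ball content_cball unit_ball_vol_2 power_divide field_simps)
      also have "\<dots> < r" using r by (simp add: e_def)
      finally show ?thesis by (simp add: SE)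
    qed
    then show "\<exists>N. \<forall>n\<ge>N. norm (integral\<^sup>L lborel (S n) - 0) < r" by auto
  qed
  then have "integral\<^sup>L lborel (\<lambda>z. if z \<in> W then J z else 0) = 0"
    using conv LIMSEQ_unique by blast
  then have "((\<lambda>z. if z \<in> W then J z else 0) has_integral 0) UNIV"
    using has_integral_integral_lborel[OF intJ] by simp
  then show ?thesis by (simp add: has_integral_restrict_UNIV)
qed

section \<open>The map \<open>Phi\<close> and its derivative\<close>

text \<open>The infinitesimal generator of the torus action \<open>(e\<^sup>i\<^sup>p\<^sup>t v\<^sub>1, e\<^sup>-\<^sup>i\<^sup>q\<^sup>t v\<^sub>2)\<close>.\<close>

definition spin :: "nat \<Rightarrow> nat \<Rightarrow> complex \<times> complex \<Rightarrow> complex \<times> complex" where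
  "spin p q v = (\<i> * of_nat p * fst v, - \<i> * of_nat q * snd v)"

text \<open>For \<open>z \<noteq> 0\<close>, \<open>Re (h / z)\<close> and \<open>Im (h / z)\<close> are the components of \<open>h\<close> along \<open>r \<partial>\<^sub>r\<close> and
  \<open>\<partial>\<^sub>\<theta>\<close>, whose images are \<open>s u\<close> and \<open>T u\<close>. At \<open>z = 0\<close> division by zero gives the
  value \<open>0\<close>, the derivative there unless \<open>p = q = 1\<close>.\<close>

definition dPhi :: "nat \<Rightarrow> nat \<Rightarrow> complex \<Rightarrow> complex \<Rightarrow> complex \<times> complex" where
  "dPhi p q z h = (sqrt (real p * real q) * Re (h / z)) *\<^sub>R Phi p q z + Im (h / z) *\<^sub>R spin p q (Phi p q z)"

lemma has_derivative_powr_monomial: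
  assumes "z \<noteq> 0"
  shows "((\<lambda>z. of_real (cmod z powr a) * z ^ k) has_derivative
      (\<lambda>h. of_real (cmod z powr a) * z ^ k * (of_real (a * Re (h / z)) + of_nat k * (h / z)))) (at z)"
proof -
  have re: "Re (h / z) = (sgn z \<bullet> h) / cmod z" for h
    unfolding Re_divide cmod_power2[symmetric]
    by (simp add: inner_complex_def sgn_div_norm power2_eq_square divide_inverse algebra_simps)
  have n: "(cmod has_derivative (\<lambda>h. sgn z \<bullet> h)) (at z)"
    using has_derivative_norm[OF assms] by (simp add: inner_commute)
  have "((\<lambda>x. x powr a) has_derivative (\<lambda>h. a * cmod z powr (a - 1) * h)) (at (cmod z))"
    using has_real_derivative_powr[of "cmod z" a] assms by (simp add: has_field_derivative_def)
  from has_derivative_of_real[OF has_derivative_compose[OF n this], where 'a = complex]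
  have 1: "((\<lambda>z. of_real (cmod z powr a)) has_derivative
      (\<lambda>h. of_real (cmod z powr a) * of_real (a * Re (h / z)) :: complex)) (at z)"
    using assms by (simp add: re powr_diff mult_ac)
  have "((\<lambda>z. z ^ k) has_derivative (\<lambda>h. of_nat k * z ^ (k - 1) * h)) (at z)"
    using DERIV_power[OF DERIV_ident, where n = k] by (simp add: has_field_derivative_def)
  moreover have "of_nat k * z ^ (k - 1) = of_nat k * z ^ k / z"
    using assms by (cases k) auto
  ultimately have 2: "((\<lambda>z. z ^ k) has_derivative (\<lambda>h. of_nat k * z ^ k / z * h)) (at z)"
    by simp
  show ?thesis
    using has_derivative_mult[OF 1 2] by (simp add: algebra_simps)
qed

text \<open>The argument function jumps along the negative real axis; powers of \<open>z\<close> and its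
  conjugate avoid it.\<close>

lemma Phi_monomials:
  assumes "z \<noteq> 0"
  shows "Phi p q z =
    (sqrt (real q) / sqrt (real p + real q)) *\<^sub>R (of_real (cmod z powr (sqrt (real p * real q) - p)) * z ^ p, 0) +
    (sqrt (real p) / sqrt (real p + real q)) *\<^sub>R (0, \<i> * cnj (of_real (cmod z powr (sqrt (real p * real q) - q)) * z ^ q))"
proof -
  have e: "exp (\<i> * of_real (real k * Arg z)) = (z / of_real (cmod z)) ^ k" for k
  proof -
    have "exp (\<i> * of_real (real k * Arg z)) = cis (Arg z) ^ k"
      by (simp add: exp_of_nat_mult[symmetric] mult_ac cis_conv_exp)
    then show ?thesis
      using assms by (simp add: cis_Arg sgn_eq)
  qed
  have m: "exp (- \<i> * of_real (real k * Arg z)) = cnj ((z / of_real (cmod z)) ^ k)" for k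
    unfolding e[symmetric] exp_cnj by simp
  have pw: "cmod z powr (a - real k) = cmod z powr a / cmod z ^ k" for a k
    using assms by (simp add: powr_diff powr_realpow)
  show ?thesis
    unfolding Phi_def e m pw using assms
    by (simp add: scaleR_conv_of_real power_divide)
qed

lemma has_derivative_Phi:
  assumes "z \<noteq> 0"
  shows "(Phi p q has_derivative dPhi p q z) (at z)"
proof -
  let ?s = "sqrt (real p * real q)"
  let ?M = "\<lambda>k z. of_real (cmod z powr (?s - real k)) * z ^ k :: complex"
  let ?c = "\<lambda>k. sqrt (real k) / sqrt (real p + real q)"
  have M: "(?M k has_derivative (\<lambda>h. ?M k z * (of_real (?s * Re (h / z)) + \<i> * of_nat k * of_real (Im (h / z))))) (at z)" for k
  proof -
    have "of_real ((?s - real k) * Re w) + of_nat k * w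
        = of_real (?s * Re w) + \<i> * of_nat k * of_real (Im w)" for w
      by (simp add: complex_eq_iff algebra_simps)
    then show ?thesis
      using has_derivative_powr_monomial[OF assms, of "?s - real k" k] by (simp only:)
  qed
  have "((\<lambda>z. ?c q *\<^sub>R (?M p z, 0) + ?c p *\<^sub>R (0, \<i> * cnj (?M q z))) has_derivative
     (\<lambda>h. ?c q *\<^sub>R (?M p z * (of_real (?s * Re (h / z)) + \<i> * of_nat p * of_real (Im (h / z))), 0) +
       ?c p *\<^sub>R (0, \<i> * cnj (?M q z * (of_real (?s * Re (h / z)) + \<i> * of_nat q * of_real (Im (h / z))))))) (at z)"
    by (intro has_derivative_add has_derivative_scaleR_right has_derivative_Pair has_derivative_const M
      has_derivative_mult_right bounded_linear.has_derivative[OF bounded_linear_cnj])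
  also have "(\<lambda>h. ?c q *\<^sub>R (?M p z * (of_real (?s * Re (h / z)) + \<i> * of_nat p * of_real (Im (h / z))), 0) +
       ?c p *\<^sub>R (0, \<i> * cnj (?M q z * (of_real (?s * Re (h / z)) + \<i> * of_nat q * of_real (Im (h / z)))))) =
       dPhi p q z"
    unfolding dPhi_def Phi_monomials[OF assms] spin_def
    by (rule ext) (simp add: scaleR_conv_of_real algebra_simps)
  finally show ?thesis
    by (rule has_derivative_transform_within_open[of _ _ _ _ "- {0}"])
      (use assms in \<open>auto simp: Phi_monomials\<close>)
qed

lemma linear_spin: "linear (spin p q)"
  by (rule linearI) (auto simp: spin_def algebra_simps)

lemma norm_spin_le: "norm (spin p q v) \<le> (real p + real q) * norm v"
proof -
  have "norm (spin p q v) \<le> real p * norm (fst v) + real q * norm (snd v)"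
    unfolding spin_def by (rule order_trans[OF norm_Pair_le]) (simp add: norm_mult)
  also have "\<dots> \<le> real p * norm v + real q * norm v"
    using norm_fst_le[of "fst v" "snd v"] norm_snd_le[of "snd v" "fst v"]
    by (intro add_mono mult_left_mono) auto
  finally show ?thesis by (simp add: algebra_simps)
qed

lemma Phi_0: "Phi p q 0 = 0"
  by (simp add: Phi_def zero_prod_def)

lemma norm_Phi:
  assumes "p > 0"
  shows "norm (Phi p q z) = cmod z powr sqrt (real p * real q)"
proof -
  have e: "cmod (exp (\<i> * of_real t)) = 1" "cmod (exp (- \<i> * of_real t)) = 1" for t
    using norm_exp_i_times[of t] norm_exp_i_times[of "- t"] by auto
  have "norm (of_real (sqrt (real q)) * exp (\<i> * of_real (real p * Arg z)),
        \<i> * of_real (sqrt (real p)) * exp (- \<i> * of_real (real q * Arg z))) = sqrt (real p + real q)"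
    unfolding norm_Pair norm_mult e by (simp add: add.commute)
  then show ?thesis
    unfolding Phi_def norm_scaleR using assms by simp
qed

lemma norm_dPhi_le:
  assumes "p > 0"
  shows "norm (dPhi p q z h) \<le>
    (sqrt (real p * real q) + real p + real q) * cmod z powr (sqrt (real p * real q) - 1) * norm h"
proof (cases "z = 0")
  case True
  then show ?thesis by (simp add: dPhi_def)
next
  case False
  let ?s = "sqrt (real p * real q)"
  have "norm (dPhi p q z h) \<le> \<bar>?s * Re (h / z)\<bar> * norm (Phi p q z) +
      \<bar>Im (h / z)\<bar> * norm (spin p q (Phi p q z))"
    unfolding dPhi_def by (rule norm_triangle_le) simp
  also have "\<dots> \<le> (?s * cmod (h / z)) * norm (Phi p q z) + cmod (h / z) * ((real p + real q) * norm (Phi p q z))"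
    by (intro add_mono mult_mono norm_spin_le abs_Im_le_cmod)
      (auto simp: abs_mult intro!: mult_left_mono abs_Re_le_cmod)
  also have "\<dots> = (?s + real p + real q) * cmod z powr (?s - 1) * norm h"
    using False by (simp add: norm_Phi[OF assms] norm_divide powr_diff field_simps)
  finally show ?thesis .
qed

lemma sqrt_mult_nat_ge_1:
  assumes "p > 0" "q > 0"
  shows "sqrt (real p * real q) \<ge> 1"
proof -
  have "1 \<le> p * q" using assms by (simp add: Suc_leI)
  then have "1 \<le> real p * real q" by (metis of_nat_1 of_nat_le_iff of_nat_mult)
  then show ?thesis by simp
qed

lemma isCont_Phi:
  assumes "p > 0" "q > 0"
  shows "isCont (Phi p q) z"
proof (cases "z = 0")
  case False
  then show ?thesis using has_derivative_continuous[OF has_derivative_Phi] by blast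
next
  case True
  have "((\<lambda>z. cmod z powr sqrt (real p * real q)) \<longlongrightarrow> 0) (at (0::complex))"
    using sqrt_mult_nat_ge_1[OF assms]
    by (intro tendsto_zero_powrI[where b = "sqrt (real p * real q)"]) (auto intro!: tendsto_eq_intros)
  then have "(Phi p q \<longlongrightarrow> 0) (at 0)"
    using tendsto_norm_zero_iff[of "Phi p q" "at 0"] norm_Phi[OF assms(1)] by simp
  then show ?thesis using True by (simp add: continuous_within Phi_0)
qed

lemma isCont_dPhi:
  assumes "p > 0" "q > 0" "z \<noteq> 0"
  shows "isCont (\<lambda>z. dPhi p q z h) z"
  unfolding dPhi_def spin_def using assms(3)
  by (intro continuous_intros isCont_Phi assms) auto

lemma Phi_1_1_eq: "Phi 1 1 z = (1 / sqrt 2) *\<^sub>R (z, \<i> * cnj z)"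
proof (cases "z = 0")
  case True
  then show ?thesis by (simp add: Phi_def)
next
  case False
  then show ?thesis by (simp add: Phi_monomials)
qed

text \<open>The derivative has size \<open>|z|\<^sup>s\<^sup>-\<^sup>1\<close>. If \<open>p q > 1\<close> then \<open>s > 1\<close> and it extends
  continuously by \<open>0\<close> to the origin; if \<open>p = q = 1\<close> the map is linear.\<close>

lemma C1_closed_disc_Phi:
  assumes pq: "p > 0" "q > 0"
  shows "C1_closed_disc (Phi p q)"
proof (cases "p * q = 1")
  case True
  then have [simp]: "p = 1" "q = 1" by auto
  have bl: "bounded_linear (Phi 1 1)"
    unfolding Phi_1_1_eq[abs_def]
    by (intro bounded_linear_const_scaleR bounded_linear_Pair bounded_linear_ident
        bounded_linear_const_mult bounded_linear_cnj)
  then have "(Phi 1 1 has_derivative blinfun_apply (Blinfun (Phi 1 1))) (at z within cball 0 1)" for z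
    by (simp add: bounded_linear_Blinfun_apply bounded_linear_imp_has_derivative)
  then show ?thesis
    unfolding C1_closed_disc_def by (intro exI[of _ "\<lambda>z. Blinfun (Phi 1 1)"]) simp
next
  case False
  let ?s = "sqrt (real p * real q)"
  have "1 < p * q" using False pq by (metis less_one linorder_neqE_nat mult_is_0 not_gr_zero)
  then have "1 < real p * real q" by (metis of_nat_1 of_nat_less_iff of_nat_mult)
  then have s: "?s > 1" by simp
  have lim0: "((\<lambda>z. cmod z powr (?s - 1)) \<longlongrightarrow> 0) (at (0::complex))"
    using s by (intro tendsto_zero_powrI[where b = "?s - 1"]) (auto intro!: tendsto_eq_intros)
  have der: "(Phi p q has_derivative dPhi p q z) (at z)" for z
  proof (cases "z = 0")
    case True
    have "dPhi p q 0 = (\<lambda>h. 0)" by (simp add: dPhi_def fun_eq_iff)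
    moreover have "((\<lambda>y. norm (Phi p q y - Phi p q 0 - 0) / norm (y - 0)) \<longlongrightarrow> 0) (at 0)"
    proof (rule Lim_transform_eventually[OF lim0])
      show "\<forall>\<^sub>F y in at 0. cmod y powr (?s - 1) = norm (Phi p q y - Phi p q 0 - 0) / norm (y - 0)"
        by (auto simp: eventually_at_filter norm_Phi pq powr_diff Phi_0)
    qed
    ultimately show ?thesis
      using True by (simp add: has_derivative_iff_norm)
  qed (rule has_derivative_Phi)
  then have ap: "blinfun_apply (Blinfun (dPhi p q z)) = dPhi p q z" for z
    by (rule bounded_linear_Blinfun_apply[OF has_derivative_bounded_linear])
  have "isCont (\<lambda>z. dPhi p q z h) z" for z h
  proof (cases "z = 0")
    case True
    have "((\<lambda>z. dPhi p q z h) \<longlongrightarrow> 0) (at 0)"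
    proof (rule Lim_null_comparison)
      show "((\<lambda>z. (?s + real p + real q) * cmod z powr (?s - 1) * norm h) \<longlongrightarrow> 0) (at 0)"
        by (intro tendsto_mult_left_zero tendsto_mult_right_zero lim0)
    qed (use norm_dPhi_le[OF pq(1)] in \<open>auto intro!: always_eventually\<close>)
    then show ?thesis using True by (simp add: continuous_within dPhi_def)
  qed (rule isCont_dPhi[OF pq])
  then have "continuous_on (cball 0 1) (\<lambda>z. Blinfun (dPhi p q z))"
    by (intro continuous_on_blinfun_componentwise continuous_at_imp_continuous_on ballI)
      (simp add: ap)
  then show ?thesis
    unfolding C1_closed_disc_def using der
    by (intro exI[of _ "\<lambda>z. Blinfun (dPhi p q z)"]) (auto simp: ap has_derivative_at_withinI)
qed

text \<open>The image of the derivative is spanned by \<open>u\<close> and \<open>T u\<close>, and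
  \<open>\<omega>(u, T u) = p |u\<^sub>1|\<^sup>2 - q |u\<^sub>2|\<^sup>2\<close>; the weights \<open>\<surd>q\<close> and \<open>\<surd>p\<close> balance the two terms.\<close>

lemma lagrangian_Phi: "lagrangian (Phi p q)"
proof -
  let ?s = "sqrt (real p * real q)"
  have "symp_form (Phi p q z) (spin p q (Phi p q z)) = 0" for z
  proof -
    have e: "cmod (exp (\<i> * of_real t)) = 1" "cmod (exp (- \<i> * of_real t)) = 1" for t
      using norm_exp_i_times[of t] norm_exp_i_times[of "- t"] by auto
    have "symp_form v (spin p q v) = real p * (cmod (fst v))\<^sup>2 - real q * (cmod (snd v))\<^sup>2" for v
      unfolding symp_form_def spin_def cmod_power2 by (simp add: power2_eq_square algebra_simps)
    moreover have "(cmod (fst (Phi p q z)))\<^sup>2 = (cmod z powr ?s / sqrt (real p + real q))\<^sup>2 * real q"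
      "(cmod (snd (Phi p q z)))\<^sup>2 = (cmod z powr ?s / sqrt (real p + real q))\<^sup>2 * real p"
      unfolding Phi_def fst_scaleR snd_scaleR fst_conv snd_conv norm_scaleR norm_mult e
      by (simp_all add: power_mult_distrib power_divide)
    ultimately show ?thesis by simp
  qed
  moreover have "symp_form (a *\<^sub>R x + b *\<^sub>R y) (c *\<^sub>R x + d *\<^sub>R y) = (a * d - b * c) * symp_form x y"
    for a b c d x y
    by (simp add: symp_form_def algebra_simps)
  ultimately have "symp_form (dPhi p q z v) (dPhi p q z w) = 0" for z v w
    unfolding dPhi_def by simp
  then have "z \<noteq> 0 \<Longrightarrow> symp_form (frechet_derivative (Phi p q) (at z) v) (frechet_derivative (Phi p q) (at z) w) = 0" for z v w
    by (simp add: frechet_derivative_at[OF has_derivative_Phi, symmetric])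
  then have "AE z in lborel. z \<notin> {0} \<longrightarrow> (z \<in> ball 0 1 \<longrightarrow>
      (\<forall>v w. symp_form (frechet_derivative (Phi p q) (at z) v) (frechet_derivative (Phi p q) (at z) w) = 0))"
    by (intro AE_I2) auto
  moreover have "AE z in lborel. z \<notin> {0::complex}"
    by (rule AE_not_in) (simp add: finite_imp_null_set_lborel)
  ultimately show ?thesis
    unfolding lagrangian_def by eventually_elim simp
qed

section \<open>Gradients and second derivatives\<close>

lemma smooth_on_UNIV_gradient:
  fixes f :: "'a::euclidean_space \<Rightarrow> real"
  assumes "smooth_on UNIV f"
  obtains H where "\<And>x. (f has_derivative (\<lambda>h. grad f x \<bullet> h)) (at x)"
    "\<And>x. (grad f has_derivative H x) (at x)" "\<And>h. continuous_on UNIV (\<lambda>x. H x h)"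
proof -
  define d where "d x v = frechet_derivative f (at x) v" for x v
  define D where "D v x = frechet_derivative (\<lambda>x. d x v) (at x)" for v x
  have "Ck_on (Suc (Suc 0)) UNIV f" using assms unfolding smooth_on_def by blast
  then have df: "(f has_derivative d x) (at x)" and
    dd: "((\<lambda>x. d x v) has_derivative D v x) (at x)" and cD: "continuous_on UNIV (\<lambda>x. D v x w)" for x v w
    unfolding d_def D_def by (auto simp: frechet_derivative_works)
  have dsum: "d x h = (\<Sum>b\<in>Basis. d x b *\<^sub>R b) \<bullet> h" for x h
  proof -
    have "linear (d x)" using has_derivative_linear[OF df] .
    then have "d x (\<Sum>b\<in>Basis. (h \<bullet> b) *\<^sub>R b) = (\<Sum>b\<in>Basis. (h \<bullet> b) * d x b)"
      by (simp add: linear_sum linear_scale)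
    moreover have "(\<Sum>b\<in>Basis. d x b *\<^sub>R b) \<bullet> h = (\<Sum>b\<in>Basis. (h \<bullet> b) * d x b)"
      unfolding inner_sum_left by (simp add: inner_commute mult.commute)
    ultimately show ?thesis
      by (simp add: euclidean_representation)
  qed
  have gr: "grad f x = (\<Sum>b\<in>Basis. d x b *\<^sub>R b)" for x
    unfolding grad_def
  proof (rule the_equality)
    have "d x = (\<lambda>h. h \<bullet> (\<Sum>b\<in>Basis. d x b *\<^sub>R b))"
      by (rule ext) (subst inner_commute, rule dsum)
    then show "GDERIV f x :> (\<Sum>b\<in>Basis. d x b *\<^sub>R b)"
      unfolding gderiv_def using df[of x] by metis
    fix E assume "GDERIV f x :> E"
    then have "(\<lambda>h. h \<bullet> E) = d x"
      unfolding gderiv_def using has_derivative_unique[OF _ df[of x]] by blast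
    then have "\<forall>h. h \<bullet> E = h \<bullet> (\<Sum>b\<in>Basis. d x b *\<^sub>R b)"
      using dsum by (metis inner_commute)
    then show "E = (\<Sum>b\<in>Basis. d x b *\<^sub>R b)"
      by (simp add: vector_eq_ldot)
  qed
  show thesis
  proof
    show "(f has_derivative (\<lambda>h. grad f x \<bullet> h)) (at x)" for x
      using df[of x] unfolding gr dsum[symmetric] by simp
    show "(grad f has_derivative (\<lambda>h. \<Sum>b\<in>Basis. D b x h *\<^sub>R b)) (at x)" for x
      unfolding gr[abs_def] by (intro has_derivative_sum has_derivative_scaleR_left dd)
    show "continuous_on UNIV (\<lambda>x. \<Sum>b\<in>Basis. D b x h *\<^sub>R b)" for h
      by (intro continuous_intros cD)
  qed
qed

lemma bounded_linear_family_on_compact: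
  fixes H :: "'c::topological_space \<Rightarrow> 'a::euclidean_space \<Rightarrow> 'b::real_normed_vector"
  assumes "compact S" and lin: "\<And>x. linear (H x)" and cont: "\<And>h. continuous_on S (\<lambda>x. H x h)"
  obtains K where "K \<ge> 0" "\<And>x h. x \<in> S \<Longrightarrow> norm (H x h) \<le> K * norm h"
proof -
  have "\<exists>k. \<forall>x\<in>S. norm (H x b) \<le> k" for b
    using compact_imp_bounded[OF compact_continuous_image[OF cont[of b] \<open>compact S\<close>]]
    by (auto simp: bounded_iff)
  then obtain k where k: "\<And>x b. x \<in> S \<Longrightarrow> norm (H x b) \<le> k b" by metis
  show thesis
  proof
    show "(\<Sum>b\<in>Basis. \<bar>k b\<bar>) \<ge> 0" by (intro sum_nonneg) auto
    fix x h assume x: "x \<in> S"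
    have "H x h = H x (\<Sum>b\<in>Basis. (h \<bullet> b) *\<^sub>R b)" by (simp add: euclidean_representation)
    also have "\<dots> = (\<Sum>b\<in>Basis. (h \<bullet> b) *\<^sub>R H x b)"
      using lin by (simp add: linear_sum linear_scale)
    also have "norm \<dots> \<le> (\<Sum>b\<in>Basis. norm ((h \<bullet> b) *\<^sub>R H x b))" by (rule norm_sum)
    also have "\<dots> \<le> (\<Sum>b\<in>Basis. norm h * \<bar>k b\<bar>)"
      using k[OF x] Basis_le_norm by (intro sum_mono) (auto intro!: mult_mono order_trans[OF k[OF x] abs_ge_self])
    finally show "norm (H x h) \<le> (\<Sum>b\<in>Basis. \<bar>k b\<bar>) * norm h"
      by (simp add: sum_distrib_left[symmetric] mult.commute)
  qed
qed

section \<open>Hamiltonian stationarity\<close>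

text \<open>The trace may be taken in the orthogonal frame \<open>z, i z\<close>, that is, in the radial and the
  angular direction, where both vectors have length \<open>|z|\<close>.\<close>

lemma rotated_basis_sum:
  fixes K L :: "complex \<Rightarrow> 'a::real_inner"
  assumes K: "linear K" and L: "linear L"
  shows "(\<Sum>e\<in>Basis. K e \<bullet> L e) * (norm z)\<^sup>2 = K z \<bullet> L z + K (\<i> * z) \<bullet> L (\<i> * z)"
proof -
  have z: "F z = Re z *\<^sub>R F 1 + Im z *\<^sub>R F \<i>" "F (\<i> * z) = (- Im z) *\<^sub>R F 1 + Re z *\<^sub>R F \<i>"
    if "linear F" for F :: "complex \<Rightarrow> 'a"
    unfolding linear_scale[OF that, symmetric] linear_add[OF that, symmetric]
    by (rule arg_cong[where f = F], simp add: complex_eq_iff)+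
  have "(norm z)\<^sup>2 = Re z * Re z + Im z * Im z"
    unfolding cmod_power2 by (simp add: power2_eq_square)
  then show ?thesis
    unfolding z[OF K] z[OF L]
    by (simp add: Basis_complex_def inner_add_left inner_add_right inner_commute algebra_simps)
qed

lemma linear_mult_I: "linear mult_I"
  by (rule linearI) (auto simp: mult_I_def algebra_simps)

lemma norm_mult_I: "norm (mult_I v) = norm v"
  by (cases v) (simp add: mult_I_def norm_Pair norm_mult)

text \<open>With \<open>s\<^sup>2 = p q\<close>, \<open>(s\<^sup>2 + T\<^sup>2) v = (q - p) (p v\<^sub>1, - q v\<^sub>2) = - (q - p) I T v\<close>, and \<open>I\<close> is an
  isometry.\<close>

lemma spin_resonance:
  "mult_I g \<bullet> ((real p * real q) *\<^sub>R v + spin p q (spin p q v)) + (real q - real p) * (g \<bullet> spin p q v) = 0"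
  by (simp add: mult_I_def spin_def inner_prod_def inner_complex_def algebra_simps)

lemma grad_eq_0_open:
  assumes "open S" "x \<in> S" "\<And>y. y \<in> S \<Longrightarrow> f y = 0"
    and "(f has_derivative (\<lambda>h. grad f x \<bullet> h)) (at x)"
  shows "grad f x = 0"
proof -
  have "((\<lambda>y. 0) has_derivative (\<lambda>h. grad f x \<bullet> h)) (at x)"
    by (rule has_derivative_transform_within_open[OF assms(4,1,2)]) (use assms(3) in auto)
  then have "(\<lambda>h. grad f x \<bullet> h) = (\<lambda>h. 0)"
    using has_derivative_unique has_derivative_const by blast
  then have "grad f x \<bullet> grad f x = 0" by metis
  then show ?thesis by simp
qed

lemma frechet_derivative_within_cball:
  fixes z :: "'a::euclidean_space"
  assumes "(u has_derivative D) (at z)" "z \<in> ball a r"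
  shows "frechet_derivative u (at z within cball a r) = D"
proof -
  have "at z within cball a r = at z"
    using assms(2) by (intro at_within_interior) (simp add: interior_cball)
  then show ?thesis using frechet_derivative_at[OF assms(1)] by simp
qed

text \<open>Here \<open>stokes_punctured_disc\<close> is applied on \<open>U\<close> minus the circle and the origin, a null set.
  That \<open>A\<close> is small near the circle and the origin follows from compactness: on the
  closure of \<open>U\<close>, the continuous function \<open>A\<close> vanishes at the origin and on the circle, so \<open>\<tau>\<close> has a
  positive minimum where \<open>|A| \<ge> e\<close>.\<close>

lemma Phi_Hamiltonian_stationary:
  assumes pq: "p > 0" "q > 0"
    and U: "openin (top_of_set (cball 0 1)) U"
    and f: "smooth_on UNIV f"
    and supp: "closure {x. f x \<noteq> 0} \<inter> Phi p q ` (frontier U \<inter> ball 0 1) = {}"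
    and tangent: "\<And>z. z \<in> closure U \<Longrightarrow> norm z = 1 \<Longrightarrow> mult_I (grad f (Phi p q z)) \<bullet> Phi p q z = 0"
  shows "(diff_pairing (\<lambda>z. mult_I (grad f (Phi p q z))) (Phi p q) has_integral 0) U"
proof -
  define s where "s = sqrt (real p * real q)"
  define u where "u = Phi p q"
  define T where "T = spin p q"
  define du where "du = dPhi p q"
  obtain H where df: "\<And>x. (f has_derivative (\<lambda>h. grad f x \<bullet> h)) (at x)"
    and dg: "\<And>x. (grad f has_derivative H x) (at x)" and cH: "\<And>h. continuous_on UNIV (\<lambda>x. H x h)"
    by (rule smooth_on_UNIV_gradient[OF f], rule that, assumption+)
  define X where "X z = mult_I (grad f (u z))" for z
  define dX where "dX z h = mult_I (H (u z) (du z h))" for z h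
  define A where "A z = s * (X z \<bullet> u z)" for z
  define B where "B z = X z \<bullet> T (u z) + (real q - real p) * f (u z)" for z
  define A' where "A' z h = s * (X z \<bullet> du z h + dX z h \<bullet> u z)" for z h
  define B' where "B' z h = X z \<bullet> T (du z h) + dX z h \<bullet> T (u z) + (real q - real p) * (grad f (u z) \<bullet> du z h)" for z h
  define J where "J z = (\<Sum>e\<in>Basis. dX z e \<bullet> du z e)" for z
  define W where "W = U \<inter> ball 0 1 - {0}"
  have s1: "s \<ge> 1" unfolding s_def by (rule sqrt_mult_nat_ge_1[OF pq])
  have blI: "bounded_linear mult_I" using linear_mult_I by (simp add: linear_linear)
  have blT: "bounded_linear T" unfolding T_def using linear_spin by (simp add: linear_linear)
  have linH: "linear (H x)" for x using has_derivative_linear[OF dg] .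
  have cf: "isCont f x" for x using df has_derivative_continuous by blast
  have cg: "isCont (grad f) x" for x using dg has_derivative_continuous by blast
  have cu: "isCont u z" for z unfolding u_def by (rule isCont_Phi[OF pq])
  have cX: "isCont X z" for z
    unfolding X_def by (intro bounded_linear.isCont[OF blI] isCont_o2[OF cu cg])
  have cA: "isCont A z" for z unfolding A_def by (intro continuous_intros cX cu)

  have W: "open W" "W \<subseteq> ball 0 1 - {0}"
  proof -
    obtain O' where "open O'" "U = cball 0 1 \<inter> O'"
      using U by (auto simp: openin_open)
    then have "W = O' \<inter> ball 0 1 - {0}" by (auto simp: W_def)
    then show "open W" using \<open>open O'\<close> by (simp add: open_Diff open_Int)
  qed (auto simp: W_def)
  have clW: "closure W \<subseteq> closure U" by (intro closure_mono) (auto simp: W_def)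
  have nz: "z \<noteq> 0" "norm z < 1" if "z \<in> W" for z using that W(2) by auto
  have ddu: "(u has_derivative du z) (at z)" if "z \<noteq> 0" for z
    unfolding u_def du_def by (rule has_derivative_Phi[OF that])
  have lindu: "linear (du z)" if "z \<noteq> 0" for z
    using has_derivative_linear[OF ddu[OF that]] .
  have dgu: "((\<lambda>z. grad f (u z)) has_derivative (\<lambda>h. H (u z) (du z h))) (at z)" if "z \<noteq> 0" for z
    by (rule has_derivative_compose[OF ddu[OF that] dg])
  have ddX: "(X has_derivative dX z) (at z)" if "z \<noteq> 0" for z
    unfolding X_def dX_def by (rule bounded_linear.has_derivative[OF blI dgu[OF that]])
  have lindX: "linear (dX z)" if "z \<noteq> 0" for z
    using has_derivative_linear[OF ddX[OF that]] .
  have dfu: "((\<lambda>z. f (u z)) has_derivative (\<lambda>h. grad f (u z) \<bullet> du z h)) (at z)" if "z \<noteq> 0" for z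
    by (rule has_derivative_compose[OF ddu[OF that] df])
  have derA: "(A has_derivative A' z) (at z)" if "z \<in> W" for z
    unfolding A_def A'_def using nz[OF that]
    by (intro has_derivative_mult_right has_derivative_inner ddX ddu)
  have derB: "(B has_derivative B' z) (at z)" if "z \<in> W" for z
    unfolding B_def B'_def using nz[OF that]
    by (intro has_derivative_add has_derivative_mult_right has_derivative_inner ddX dfu
        bounded_linear.has_derivative[OF blT ddu])

  have nu: "norm (u z) = norm z powr s" for z
    unfolding u_def s_def by (rule norm_Phi[OF pq(1)])
  have u1: "norm (u z) \<le> 1" if "norm z \<le> 1" for z
    unfolding nu using powr_le1[of s "norm z"] s1 that by simp
  have IX: "norm (X z) = norm (grad f (u z))" for z by (simp add: X_def norm_mult_I)
  obtain Kf where Kf: "\<And>x. norm x \<le> 1 \<Longrightarrow> \<bar>f x\<bar> \<le> Kf"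
    using compact_imp_bounded[OF compact_continuous_image[of "cball 0 1" f]] cf
    by (fastforce simp: bounded_iff intro: continuous_at_imp_continuous_on)
  obtain Kg where Kg: "\<And>x. norm x \<le> 1 \<Longrightarrow> norm (grad f x) \<le> Kg"
    using compact_imp_bounded[OF compact_continuous_image[of "cball 0 1" "grad f"]] cg
    by (fastforce simp: bounded_iff intro: continuous_at_imp_continuous_on)
  obtain KH where KH: "KH \<ge> 0" "\<And>x h. norm x \<le> 1 \<Longrightarrow> norm (H x h) \<le> KH * norm h"
  proof (rule bounded_linear_family_on_compact[of "cball 0 1" H])
    show "continuous_on (cball 0 1) (\<lambda>x. H x h)" for h
      by (rule continuous_on_subset[OF cH]) simp
  qed (use linH that in auto)
  define Ku where "Ku = s + real p + real q"
  define KT where "KT = real p + real q"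
  have K0: "Ku \<ge> 0" "KT \<ge> 0" using s1 by (auto simp: Ku_def KT_def)
  have Kg0: "Kg \<ge> 0" using order_trans[OF norm_ge_zero Kg[of 0]] by simp
  have Kf0: "Kf \<ge> 0" using order_trans[OF abs_ge_zero Kf[of 0]] by simp
  have bdu: "norm (du z h) \<le> Ku * norm h" if "norm z \<le> 1" for z h
  proof -
    have "norm (du z h) \<le> Ku * norm z powr (s - 1) * norm h"
      unfolding du_def Ku_def s_def by (rule norm_dPhi_le[OF pq(1)])
    also have "\<dots> \<le> Ku * 1 * norm h"
      using that s1 K0 by (intro mult_right_mono mult_left_mono powr_le1) auto
    finally show ?thesis by simp
  qed
  have bdX: "norm (dX z h) \<le> KH * Ku * norm h" if "norm z \<le> 1" for z h
  proof -
    have "norm (dX z h) \<le> KH * norm (du z h)"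
      unfolding dX_def norm_mult_I using KH(2) u1[OF that] by blast
    also have "\<dots> \<le> KH * (Ku * norm h)"
      using bdu[OF that] KH(1) by (rule mult_left_mono)
    finally show ?thesis by simp
  qed
  have bX: "norm (X z) \<le> Kg" if "norm z \<le> 1" for z
    unfolding IX using Kg u1[OF that] by blast
  have bT: "norm (T v) \<le> KT * norm v" for v
    unfolding T_def KT_def by (rule norm_spin_le)
  have in_le: "\<bar>a \<bullet> b\<bar> \<le> c * d" if "norm a \<le> c" "norm b \<le> d" for a b :: "complex \<times> complex" and c d
    using that norm_ge_zero[of a] norm_ge_zero[of b]
    by (intro order_trans[OF Cauchy_Schwarz_ineq2] mult_mono) linarith+
  define N where "N = \<bar>real q - real p\<bar>"
  have bTu: "norm (T (u z)) \<le> KT" if "norm z \<le> 1" for z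
    using order_trans[OF bT mult_left_mono[OF u1[OF that] K0(2)]] by simp
  have bTdu: "norm (T (du z h)) \<le> KT * (Ku * norm h)" if "norm z \<le> 1" for z h
    using order_trans[OF bT mult_left_mono[OF bdu[OF that] K0(2)]] .
  \<comment> \<open>Bounds for \<open>A\<close>, \<open>B\<close>, \<open>A'\<close>, \<open>B'\<close> and \<open>J\<close>, in this order.\<close>
  define M1 where "M1 = s * (Kg * 1)"
  define M2 where "M2 = Kg * KT + N * Kf"
  define M3 where "M3 = s * (Kg * Ku + KH * Ku * 1)"
  define M4 where "M4 = Kg * (KT * Ku) + KH * Ku * KT + N * (Kg * Ku)"
  define M5 where "M5 = 2 * ((KH * Ku) * Ku)"
  define M where "M = M1 + M2 + M3 + M4 + M5"
  have Mpos: "M1 \<ge> 0" "M2 \<ge> 0" "M3 \<ge> 0" "M4 \<ge> 0" "M5 \<ge> 0"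
    unfolding M1_def M2_def M3_def M4_def M5_def N_def using s1 Kg0 K0 Kf0 KH(1) by simp_all
  have Mge: "M1 \<le> M" "M2 \<le> M" "M3 \<le> M" "M4 \<le> M" "M5 \<le> M" unfolding M_def using Mpos by linarith+
  have bA: "\<bar>A z\<bar> \<le> M1" if "norm z \<le> 1" for z
    unfolding A_def M1_def abs_mult using s1 in_le[OF bX u1, OF that that] by simp
  have bB: "\<bar>B z\<bar> \<le> M2" if "norm z \<le> 1" for z
  proof -
    have "\<bar>(real q - real p) * f (u z)\<bar> \<le> N * Kf"
      unfolding abs_mult N_def using Kf u1[OF that] by (intro mult_left_mono) auto
    moreover have "\<bar>X z \<bullet> T (u z)\<bar> \<le> Kg * KT" by (rule in_le[OF bX bTu, OF that that])
    ultimately show ?thesis unfolding B_def M2_def by linarith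
  qed
  have bA': "\<bar>A' z h\<bar> \<le> M3 * norm h" if "norm z \<le> 1" for z h
  proof -
    have "\<bar>X z \<bullet> du z h\<bar> \<le> Kg * (Ku * norm h)" by (rule in_le[OF bX bdu, OF that that])
    moreover have "\<bar>dX z h \<bullet> u z\<bar> \<le> KH * Ku * norm h * 1" by (rule in_le[OF bdX u1, OF that that])
    ultimately have "\<bar>X z \<bullet> du z h + dX z h \<bullet> u z\<bar> \<le> (Kg * Ku + KH * Ku * 1) * norm h"
      by (simp add: algebra_simps)
    then show ?thesis unfolding A'_def M3_def abs_mult mult.assoc[of s]
      using s1 by (simp add: mult_left_mono)
  qed
  have bB': "\<bar>B' z h\<bar> \<le> M4 * norm h" if "norm z \<le> 1" for z h
  proof -
    have "\<bar>X z \<bullet> T (du z h)\<bar> \<le> Kg * (KT * (Ku * norm h))" by (rule in_le[OF bX bTdu, OF that that])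
    moreover have "\<bar>dX z h \<bullet> T (u z)\<bar> \<le> KH * Ku * norm h * KT" by (rule in_le[OF bdX bTu, OF that that])
    moreover have "\<bar>(real q - real p) * (grad f (u z) \<bullet> du z h)\<bar> \<le> N * (Kg * (Ku * norm h))"
      unfolding abs_mult N_def using Kg u1[OF that] bdu[OF that]
      by (intro mult_left_mono in_le) auto
    moreover have "M4 * norm h = Kg * (KT * (Ku * norm h)) + KH * Ku * norm h * KT + N * (Kg * (Ku * norm h))"
      by (simp add: M4_def algebra_simps)
    ultimately show ?thesis unfolding B'_def by linarith
  qed
  have bJ: "\<bar>J z\<bar> \<le> M5" if "norm z \<le> 1" for z
  proof -
    have "\<bar>dX z e \<bullet> du z e\<bar> \<le> (KH * Ku) * Ku" if "norm e = 1" for e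
      using in_le[OF bdX bdu, OF \<open>norm z \<le> 1\<close> \<open>norm z \<le> 1\<close>, of e e] that by simp
    from this[of 1] this[of \<i>] show ?thesis unfolding J_def M5_def
      by (simp add: Basis_complex_def)
  qed

  have "(J has_integral 0) W"
  proof (rule stokes_punctured_disc[OF W derA derB, where M = M])
    fix z assume z: "z \<in> W"
    then have z1: "norm z \<le> 1" using nz(2) by force
    show "\<bar>A z\<bar> \<le> M" using bA[OF z1] Mge by linarith
    show "\<bar>B z\<bar> \<le> M" using bB[OF z1] Mge by linarith
    show "\<bar>J z\<bar> \<le> M" using bJ[OF z1] Mge by linarith
    show "\<bar>A' z h\<bar> \<le> M * norm h" for h
      using bA'[OF z1, of h] mult_right_mono[OF Mge(3), of "norm h"] by auto
    show "\<bar>B' z h\<bar> \<le> M * norm h" for h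
      using bB'[OF z1, of h] mult_right_mono[OF Mge(4), of "norm h"] by auto
    have z0: "z \<noteq> 0" using nz(1)[OF z] .
    have ss: "s * s = real p * real q" by (simp add: s_def)
    have "du z z = s *\<^sub>R u z" "du z (\<i> * z) = T (u z)"
      using z0 by (simp_all add: du_def dPhi_def s_def u_def T_def)
    moreover note rotated_basis_sum[OF lindX[OF z0] lindu[OF z0], of z]
    moreover have "(s * s) * (X z \<bullet> u z) + X z \<bullet> T (T (u z)) + (real q - real p) * (grad f (u z) \<bullet> T (u z)) = 0"
      using spin_resonance[of "grad f (u z)" p q "u z"] ss
      by (simp add: X_def T_def inner_add_right)
    ultimately show "J z * (norm z)\<^sup>2 = A' z z + B' z (\<i> * z)"
      unfolding J_def A'_def B'_def by (simp add: algebra_simps)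
  next
    fix z assume z: "z \<in> frontier W" "z \<noteq> 0" "norm z < 1"
    have "z \<in> frontier U \<inter> ball 0 1"
    proof -
      have "z \<in> closure U" using z(1) clW by (auto simp: frontier_def)
      moreover have "z \<notin> interior U"
      proof
        assume "z \<in> interior U"
        then have "z \<in> W" using z(2,3) interior_subset by (auto simp: W_def)
        then show False using z(1) W(1) by (simp add: frontier_def interior_open)
      qed
      ultimately show ?thesis using z(3) by (auto simp: frontier_def)
    qed
    then have uz: "u z \<in> - closure {x. f x \<noteq> 0}" using supp unfolding u_def by auto
    have "(u \<longlongrightarrow> u z) (nhds z)" using cu[of z] by (simp add: continuous_at tendsto_at_iff_tendsto_nhds)
    then have "\<forall>\<^sub>F w in nhds z. u w \<in> - closure {x. f x \<noteq> 0}"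
      by (rule topological_tendstoD) (use uz in auto)
    then show "\<forall>\<^sub>F w in nhds z. w \<in> W \<longrightarrow> A w = 0 \<and> B w = 0"
    proof (rule eventually_mono)
      fix w assume w: "u w \<in> - closure {x. f x \<noteq> 0}"
      have out: "f y = 0" if "y \<in> - closure {x. f x \<noteq> 0}" for y
        using that closure_subset[of "{x. f x \<noteq> 0}"] by auto
      have "grad f (u w) = 0"
        by (rule grad_eq_0_open[OF _ w out df]) auto
      then have "X w = 0" using linear_mult_I by (simp add: X_def linear_0)
      then show "w \<in> W \<longrightarrow> A w = 0 \<and> B w = 0"
        using out[OF w] by (simp add: A_def B_def)
    qed
  next
    fix e :: real assume e: "e > 0"
    define S where "S = {z \<in> closure W. e \<le> \<bar>A z\<bar>}"
    let ?\<tau> = "\<lambda>z::complex. (norm z)\<^sup>2 * (1 - (norm z)\<^sup>2)"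
    have clb: "norm z \<le> 1" if "z \<in> closure W" for z
    proof -
      have "closure W \<subseteq> cball 0 1" using W(2) by (intro closure_minimal) auto
      then show ?thesis using that by auto
    qed
    then have "bounded W" unfolding bounded_iff using closure_subset by blast
    then have "compact (closure W)" by simp
    moreover have "S = closure W \<inter> {z. e \<le> \<bar>A z\<bar>}" by (auto simp: S_def)
    moreover have "closed {z. e \<le> \<bar>A z\<bar>}"
      by (intro closed_Collect_le continuous_intros continuous_at_imp_continuous_on ballI cA)
    ultimately have S: "compact S" by auto
    show "\<exists>d>0. \<forall>z\<in>W. ?\<tau> z < d \<longrightarrow> \<bar>A z\<bar> \<le> e"
    proof (cases "S = {}")
      case True
      then show ?thesis using closure_subset[of W] by (intro exI[of _ 1]) (force simp: S_def)
    next
      case False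
      have "continuous_on S ?\<tau>" by (intro continuous_intros)
      then obtain y where y: "y \<in> S" "\<And>z. z \<in> S \<Longrightarrow> ?\<tau> y \<le> ?\<tau> z"
        using continuous_attains_inf[OF S False, of ?\<tau>] by blast
      have "A y \<noteq> 0" using y(1) e by (auto simp: S_def)
      have "y \<noteq> 0" using \<open>A y \<noteq> 0\<close> by (auto simp: A_def u_def Phi_0)
      moreover have "norm y \<noteq> 1"
        using \<open>A y \<noteq> 0\<close> tangent[of y] y(1) clW by (auto simp: A_def X_def u_def S_def)
      moreover have "norm y \<le> 1" using y(1) clb by (auto simp: S_def)
      ultimately have "?\<tau> y > 0" by (auto simp: abs_square_less_1)
      moreover have "\<bar>A z\<bar> \<le> e" if "z \<in> W" "?\<tau> z < ?\<tau> y" for z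
        using y(2)[of z] that closure_subset[of W] by (force simp: S_def)
      ultimately show ?thesis by blast
    qed
  next
    have cdu: "isCont (\<lambda>z. du z h) z" if "z \<in> W" for z h
      unfolding du_def by (rule isCont_dPhi[OF pq nz(1)[OF that]])
    have cHu: "isCont (\<lambda>z. H (u z) b) z" for z b
      by (rule isCont_o2[OF cu]) (use cH continuous_on_eq_continuous_at in blast)
    have dX_eq: "dX z e = mult_I (\<Sum>b\<in>Basis. (du z e \<bullet> b) *\<^sub>R H (u z) b)" for z e
    proof -
      have "H (u z) (du z e) = H (u z) (\<Sum>b\<in>Basis. (du z e \<bullet> b) *\<^sub>R b)"
        by (simp add: euclidean_representation)
      then show ?thesis unfolding dX_def using linH by (simp add: linear_sum linear_scale)
    qed
    show "continuous_on W J"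
      unfolding J_def dX_eq
      by (intro continuous_at_imp_continuous_on ballI continuous_intros bounded_linear.isCont[OF blI] cdu cHu)
  qed
  moreover have "diff_pairing X u z = J z" if "z \<in> W" for z
  proof -
    have "z \<in> ball 0 1" using W(2) that by auto
    then show ?thesis
      unfolding diff_pairing_def J_def using nz(1)[OF that]
      by (simp add: frechet_derivative_within_cball[OF ddX] frechet_derivative_within_cball[OF ddu])
  qed
  ultimately have "(diff_pairing X u has_integral 0) W"
    using has_integral_cong[of W "diff_pairing X u" J 0] by blast
  moreover have "negligible (U - W)" "negligible (W - U)"
  proof -
    have "U \<subseteq> cball 0 1" using openin_imp_subset[OF U] .
    then have "U - W \<subseteq> sphere 0 1 \<union> {0}" by (auto simp: W_def)
    then show "negligible (U - W)"
      by (rule negligible_subset[rotated]) (simp add: negligible_Un negligible_sphere)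
    have "W - U = {}" by (auto simp: W_def)
    then show "negligible (W - U)" by simp
  qed
  ultimately have "(diff_pairing X u has_integral 0) U"
    using has_integral_spike_set_eq[of U W "diff_pairing X u" 0]
    by (metis (mono_tags, lifting) negligible_subset mem_Collect_eq Diff_iff subsetI)
  then show ?thesis unfolding X_def u_def .
qed

theorem lemma4p1:
  fixes p q :: nat
  assumes "p > 0" and "q > 0" and "coprime p q"
  shows "free_boundary_HSL_localization (ball 0 1) (\<lambda>x. x) (Phi p q)"
  unfolding free_boundary_HSL_localization_def
proof (intro conjI allI impI)
  show "C1_closed_disc (Phi p q)" using assms by (intro C1_closed_disc_Phi)
  show "lagrangian (Phi p q)" by (rule lagrangian_Phi)
  show "Phi p q ` sphere 0 1 \<subseteq> frontier (ball 0 1)"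
    using assms by (auto simp: norm_Phi)
next
  fix U and f :: "complex \<times> complex \<Rightarrow> real"
  assume U: "smooth_rel_domain U" and f: "smooth_on UNIV f"
    and supp: "closure {x. f x \<noteq> 0} \<inter> Phi p q ` (frontier U \<inter> ball 0 1) = {}"
    and ex: "\<exists>V. openin (top_of_set (frontier (ball 0 1))) V \<and> Phi p q ` (closure U \<inter> sphere 0 1) \<subseteq> V \<and>
             (\<forall>x\<in>V. mult_I (grad f x) \<bullet> x = 0)"
  show "(diff_pairing (\<lambda>z. mult_I (grad f (Phi p q z))) (Phi p q) has_integral 0) U"
  proof (rule Phi_Hamiltonian_stationary[OF assms(1,2) _ f supp])
    show "openin (top_of_set (cball 0 1)) U" using U by (simp add: smooth_rel_domain_def)
    fix z :: complex assume "z \<in> closure U" "norm z = 1"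
    then have "z \<in> closure U \<inter> sphere 0 1" by simp
    then show "mult_I (grad f (Phi p q z)) \<bullet> Phi p q z = 0" using ex by blast
  qed
qed

end
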